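(* Let $k$ be a field of characteristic zero and let $k[\mathbf{x}]=k[x_1,x_2,x_3]$. Set $f:=x_1x_3-x_2^2$ and $g:=x_3f^2+2x_1x_2f+x_1^3$, let $\Delta:=\Delta_{(f,g)}$ be the Jacobian derivation, which is a locally nilpotent $k$-derivation of $k[\mathbf{x}]$, and let $\phi:=\exp\Delta\in\mathrm{Aut}_kk[\mathbf{x}]$. Then $\phi$ is not co-tame, i.e. $\langle\phi,\mathrm{Aff}_3(k)\rangle\not\supset\mathrm{TA}_3(k)$.
   Context: $\mathrm{Aut}_kk[\mathbf{x}]$ is the group of $k$-algebra automorphisms of $k[\mathbf{x}]=k[x_1,x_2,x_3]$; write $\phi=(\phi(x_1),\phi(x_2),\phi(x_3))$, with composition $(\phi\circ\psi)(x_i)=\phi(\psi(x_i))$. An automorphism is affine if it is of the form $(x_1,x_2,x_3)A+\mathbf{b}$ with $A\in GL_3(k)$, $\mathbf{b}\in k^3$; it is triangular if it is of the form $(a_1x_1+f_1,a_2x_2+f_2,a_3x_3+f_3)$ with $a_i\in k^*$ and $f_i\in k[x_1,\ldots,x_{i-1}]$. $\mathrm{Aff}_3(k)$ and $\mathrm{BA}_3(k)$ denote the subgroups of affine and triangular automorphisms, and $\mathrm{TA}_3(k):=\langle\mathrm{Aff}_3(k),\mathrm{BA}_3(k)\rangle$ is the tame subgroup. An automorphism $\phi$ is co-tame if $\langle\phi,\mathrm{Aff}_3(k)\rangle\supset\mathrm{TA}_3(k)$. The Jacobian derivation is $\Delta_{(f,g)}(h):=\det\frac{\partial(f,g,h)}{\partial(x_1,x_2,x_3)}$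 for $h\in k[\mathbf{x}]$. A $k$-derivation $D$ is locally nilpotent if for every $h$ there is $l\ge1$ with $D^l(h)=0$; then $(\exp D)(h):=\sum_{i\ge0}D^i(h)/i!$ defines an automorphism. With $r:=x_2f+x_1^2$, the derivation $\Delta$ is known to be locally nilpotent and satisfies $\Delta(x_1)=-2rf$, $\Delta(x_2)=4x_1r-g$, $\Delta(x_3)=6x_2r+2f^2$, $\Delta(r)=-fg$, $\Delta(f)=\Delta(g)=0$. *)

theory Defs
  imports
    "HOL-Library.Poly_Mapping"
    "HOL-Analysis.Determinants"
    "HOL-Algebra.Generated_Groups"
begin

text \<open>
  \<open>'k pol3\<close> is the polynomial ring in three variables: finitely supported functions from
  exponent vectors to coefficients, with the convolution product. The variables
  are indexed by \<open>1, 2, 3 :: 3\<close>, as for vectors in \<open>'k^3\<close>; beware that \<open>3 = 0\<close> in this type,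
  so its linear order is not the order of the indices.
\<close>

type_synonym 'k pol3 = "(3 \<Rightarrow>\<^sub>0 nat) \<Rightarrow>\<^sub>0 'k"

definition pconst :: "'k::comm_ring_1 \<Rightarrow> 'k pol3" where
  "pconst c = Poly_Mapping.single 0 c"

definition pvar :: "3 \<Rightarrow> 'k::comm_ring_1 pol3" where
  "pvar i = Poly_Mapping.single (Poly_Mapping.single i 1) 1"

definition pols_in :: "3 set \<Rightarrow> 'k::comm_ring_1 pol3 set" where
  "pols_in V = {p. \<forall>m \<in> Poly_Mapping.keys p. Poly_Mapping.keys m \<subseteq> V}"

definition pdiff :: "3 \<Rightarrow> 'k::comm_ring_1 pol3 \<Rightarrow> 'k pol3" where
  "pdiff i p = (\<Sum>m \<in> Poly_Mapping.keys p.
     Poly_Mapping.single (m - Poly_Mapping.single i 1)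
       (of_nat (Poly_Mapping.lookup m i) * Poly_Mapping.lookup p m))"

definition pol_algebra_hom :: "('k::comm_ring_1 pol3 \<Rightarrow> 'k pol3) \<Rightarrow> bool" where
  "pol_algebra_hom \<phi> \<longleftrightarrow>
     (\<forall>p q. \<phi> (p + q) = \<phi> p + \<phi> q) \<and>
     (\<forall>p q. \<phi> (p * q) = \<phi> p * \<phi> q) \<and>
     (\<forall>c. \<phi> (pconst c) = pconst c)"

definition Aut3 :: "('k::comm_ring_1 pol3 \<Rightarrow> 'k pol3) monoid" where
  "Aut3 = \<lparr>carrier = {\<phi>. pol_algebra_hom \<phi> \<and> bij \<phi>}, mult = (\<circ>), one = id\<rparr>"

definition Aff3 :: "('k::field pol3 \<Rightarrow> 'k pol3) set" where
  "Aff3 = {\<phi> \<in> carrier Aut3. \<exists>(A :: 'k^3^3) (b :: 'k^3). invertible A \<and>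
     (\<forall>j. \<phi> (pvar j) = (\<Sum>i\<in>UNIV. pvar i * pconst (A $ i $ j)) + pconst (b $ j))}"

definition BA3 :: "('k::field pol3 \<Rightarrow> 'k pol3) set" where
  "BA3 = {\<phi> \<in> carrier Aut3. \<exists>a1 a2 a3 f1 f2 f3.
     a1 \<noteq> 0 \<and> a2 \<noteq> 0 \<and> a3 \<noteq> 0 \<and>
     f1 \<in> pols_in {} \<and> f2 \<in> pols_in {1} \<and> f3 \<in> pols_in {1, 2} \<and>
     \<phi> (pvar 1) = pconst a1 * pvar 1 + f1 \<and>
     \<phi> (pvar 2) = pconst a2 * pvar 2 + f2 \<and>
     \<phi> (pvar 3) = pconst a3 * pvar 3 + f3}"

definition TA3 :: "('k::field pol3 \<Rightarrow> 'k pol3) set" where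
  "TA3 = generate Aut3 (Aff3 \<union> BA3)"

definition co_tame :: "('k::field pol3 \<Rightarrow> 'k pol3) \<Rightarrow> bool" where
  "co_tame \<phi> \<longleftrightarrow> TA3 \<subseteq> generate Aut3 (insert \<phi> Aff3)"

definition jacobian_derivation ::
    "'k::comm_ring_1 pol3 \<Rightarrow> 'k pol3 \<Rightarrow> 'k pol3 \<Rightarrow> 'k pol3" where
  "jacobian_derivation f g h = det (\<chi> i j. pdiff j (vector [f, g, h] $ i))"

definition pol_derivation :: "('k::comm_ring_1 pol3 \<Rightarrow> 'k pol3) \<Rightarrow> bool" where
  "pol_derivation D \<longleftrightarrow>
     (\<forall>p q. D (p + q) = D p + D q) \<and>
     (\<forall>p q. D (p * q) = D p * q + p * D q) \<and>
     (\<forall>c. D (pconst c) = 0)"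

definition locally_nilpotent :: "('k::comm_ring_1 pol3 \<Rightarrow> 'k pol3) \<Rightarrow> bool" where
  "locally_nilpotent D \<longleftrightarrow> (\<forall>h. \<exists>l\<ge>1. (D ^^ l) h = 0)"

text \<open>
  \<^const>\<open>Sum_any\<close> sums over the finite support of its argument, which for a locally
  nilpotent \<open>D\<close> is the whole exponential series.
\<close>

definition exp_derivation :: "('k::field_char_0 pol3 \<Rightarrow> 'k pol3) \<Rightarrow> 'k pol3 \<Rightarrow> 'k pol3" where
  "exp_derivation D h = Sum_any (\<lambda>i. pconst (1 / fact i) * (D ^^ i) h)"


subsection \<open>Basic facts\<close>

lemma pconst_add: "pconst (a + b) = pconst a + pconst b"
  by (simp add: pconst_def single_add)

lemma pconst_mult: "pconst (a * b) = pconst a * pconst b"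
  by (simp add: pconst_def mult_single)

lemma pconst_0 [simp]: "pconst 0 = 0"
  and pconst_1 [simp]: "pconst 1 = 1"
  by (simp_all add: pconst_def)

lemma pconst_of_nat: "pconst (of_nat n) = of_nat n"
  by (simp add: pconst_def)

lemma pconst_uminus: "pconst (- a) = - pconst a"
  by (simp add: pconst_def single_uminus)

lemma pol_induct_single:
  fixes p :: "'a \<Rightarrow>\<^sub>0 'b::comm_monoid_add"
  assumes single: "\<And>m c. P (Poly_Mapping.single m c)"
    and add: "\<And>p q. P p \<Longrightarrow> P q \<Longrightarrow> P (p + q)"
  shows "P p"
proof (induction p rule: update_induct)
  case const
  show ?case using single[of undefined 0] by simp
next
  case (update p k v)
  have "Poly_Mapping.update k v p = p + Poly_Mapping.single k v"
    using update(1)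
    by (intro poly_mapping_eqI)
       (auto simp: lookup_update lookup_add lookup_single not_in_keys_iff_lookup_eq_zero)
  then show ?case using update single add by simp
qed

lemma pol_induct [case_names const var add mult]:
  fixes p :: "'k::comm_ring_1 pol3"
  assumes const: "\<And>c. P (pconst c)"
    and var: "\<And>i. P (pvar i)"
    and add: "\<And>p q. P p \<Longrightarrow> P q \<Longrightarrow> P (p + q)"
    and mult: "\<And>p q. P p \<Longrightarrow> P q \<Longrightarrow> P (p * q)"
  shows "P p"
proof (rule pol_induct_single)
  fix m :: "3 \<Rightarrow>\<^sub>0 nat" and c :: 'k
  have "P (Poly_Mapping.single m 1 :: 'k pol3)"
  proof (induction m rule: pol_induct_single)
    fix i :: 3 and n :: nat
    show "P (Poly_Mapping.single (Poly_Mapping.single i n) 1 :: 'k pol3)"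
    proof (induction n)
      case 0
      show ?case using const[of 1] by (simp add: pconst_def)
    next
      case (Suc n)
      have "Poly_Mapping.single (Poly_Mapping.single i (Suc n)) 1
        = pvar i * (Poly_Mapping.single (Poly_Mapping.single i n) 1 :: 'k pol3)"
        by (simp add: pvar_def mult_single flip: single_add)
      then show ?case using mult[OF var Suc] by simp
    qed
  next
    fix p q :: "3 \<Rightarrow>\<^sub>0 nat"
    assume "P (Poly_Mapping.single p 1 :: 'k pol3)" "P (Poly_Mapping.single q 1 :: 'k pol3)"
    from mult[OF this] show "P (Poly_Mapping.single (p + q) 1 :: 'k pol3)"
      by (simp add: mult_single)
  qed
  from mult[OF const[of c] this] show "P (Poly_Mapping.single m c)"
    by (simp add: pconst_def mult_single)
qed (rule add)

lemma pdiff_superset: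
  assumes "finite S" "Poly_Mapping.keys p \<subseteq> S"
  shows "pdiff i p = (\<Sum>m \<in> S. Poly_Mapping.single (m - Poly_Mapping.single i 1)
       (of_nat (Poly_Mapping.lookup m i) * Poly_Mapping.lookup p m))"
  unfolding pdiff_def using assms
  by (intro sum.mono_neutral_left) (auto simp: in_keys_iff)

lemma pdiff_add: "pdiff i (p + q) = pdiff i p + pdiff i q"
proof -
  let ?S = "Poly_Mapping.keys p \<union> Poly_Mapping.keys q"
  have "Poly_Mapping.keys (p + q) \<subseteq> ?S" by (rule Poly_Mapping.keys_add)
  then show ?thesis
    by (simp add: pdiff_superset[of ?S] sum.distrib lookup_add distrib_left single_add)
qed

lemma pdiff_single:
  "pdiff i (Poly_Mapping.single m c)
     = Poly_Mapping.single (m - Poly_Mapping.single i 1) (of_nat (Poly_Mapping.lookup m i) * c)"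
  by (subst pdiff_superset[of "{m}"]) auto

lemma pdiff_mult_single:
  "pdiff i (Poly_Mapping.single m c * Poly_Mapping.single n d)
     = pdiff i (Poly_Mapping.single m c) * Poly_Mapping.single n d
       + Poly_Mapping.single m c * pdiff i (Poly_Mapping.single n d)"
proof -
  let ?e = "Poly_Mapping.single i (1::nat)"
  have shift: "(a + b) - ?e = (a - ?e) + b" if "Poly_Mapping.lookup a i \<noteq> 0" for a b
    using that by (intro poly_mapping_eqI) (auto simp: lookup_minus lookup_add lookup_single when_def)
  have 1: "Poly_Mapping.single (m + n - ?e) (of_nat (Poly_Mapping.lookup m i) * (c * d))
    = Poly_Mapping.single (m - ?e + n) (of_nat (Poly_Mapping.lookup m i) * (c * d))"
    by (cases "Poly_Mapping.lookup m i = 0") (simp_all only: shift of_nat_0 mult_zero_left single_zero not_False_eq_True)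
  have 2: "Poly_Mapping.single (m + n - ?e) (of_nat (Poly_Mapping.lookup n i) * (c * d))
    = Poly_Mapping.single (m + (n - ?e)) (of_nat (Poly_Mapping.lookup n i) * (c * d))"
    using shift[of n m]
    by (cases "Poly_Mapping.lookup n i = 0")
       (simp_all only: add.commute[of m] of_nat_0 mult_zero_left single_zero not_False_eq_True)
  show ?thesis
    unfolding mult_single pdiff_single lookup_add of_nat_add distrib_right single_add 1 2
    by (simp add: mult_ac)
qed

lemma pdiff_mult: "pdiff i (p * q) = pdiff i p * q + p * pdiff i q"
proof (induction p rule: pol_induct_single)
  fix m c
  show "pdiff i (Poly_Mapping.single m c * q)
    = pdiff i (Poly_Mapping.single m c) * q + Poly_Mapping.single m c * pdiff i q"
    by (induction q rule: pol_induct_single)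
       (simp_all add: pdiff_mult_single pdiff_add algebra_simps)
qed (simp add: pdiff_add algebra_simps)

lemma pdiff_pconst [simp]: "pdiff i (pconst c) = 0"
  by (simp add: pconst_def pdiff_single)

lemma pdiff_uminus: "pdiff i (- p) = - pdiff i p" for p :: "'k::comm_ring_1 pol3"
proof -
  have "pdiff i p + pdiff i (- p) = 0"
    using pdiff_add[of i p "- p"] pdiff_pconst[of i "0 :: 'k"] by simp
  then show ?thesis by (metis neg_eq_iff_add_eq_0)
qed

lemma pdiff_minus: "pdiff i (p - q) = pdiff i p - pdiff i q"
  using pdiff_add[of i p "- q"] by (simp add: pdiff_uminus)

lemma pdiff_numeral: "pdiff i (numeral n) = 0"
  using pdiff_pconst[of i "numeral n"] by (simp add: pconst_def)

lemma pdiff_pvar: "pdiff i (pvar j) = (if i = j then 1 else 0)"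
  by (auto simp: pvar_def pdiff_single lookup_single when_def)

lemmas pdiff_simps = pdiff_add pdiff_mult pdiff_minus pdiff_numeral pdiff_pvar

lemma pol_derivation_pdiff: "pol_derivation (pdiff i)"
  by (simp add: pol_derivation_def pdiff_add pdiff_mult)

lemma jacobian_derivation_eq:
  "jacobian_derivation f g h =
     (pdiff 2 f * pdiff 3 g - pdiff 3 f * pdiff 2 g) * pdiff 1 h
   + (pdiff 3 f * pdiff 1 g - pdiff 1 f * pdiff 3 g) * pdiff 2 h
   + (pdiff 1 f * pdiff 2 g - pdiff 2 f * pdiff 1 g) * pdiff 3 h"
  by (simp add: jacobian_derivation_def det_3 algebra_simps)

lemma pol_derivation_jacobian: "pol_derivation (jacobian_derivation f g)"
  by (simp add: pol_derivation_def jacobian_derivation_eq pdiff_add pdiff_mult algebra_simps)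

lemma group_Aut3: "group (Aut3 :: ('k::comm_ring_1 pol3 \<Rightarrow> 'k pol3) monoid)"
proof (rule groupI)
  fix \<phi> :: "'k pol3 \<Rightarrow> 'k pol3"
  assume "\<phi> \<in> carrier Aut3"
  then have hom: "pol_algebra_hom \<phi>" and bij: "bij \<phi>" by (auto simp: Aut3_def)
  have right: "\<phi> (inv_into UNIV \<phi> x) = x" for x
    using bij by (simp add: bij_is_surj surj_f_inv_f)
  have inj: "x = y" if "\<phi> x = \<phi> y" for x y
    using bij that by (auto simp: bij_def inj_def)
  have "pol_algebra_hom (inv_into UNIV \<phi>)"
    unfolding pol_algebra_hom_def
    by (intro conjI allI; rule inj) (use hom in \<open>simp_all add: right pol_algebra_hom_def\<close>)
  then have "inv_into UNIV \<phi> \<in> carrier Aut3"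
    using bij by (simp add: Aut3_def bij_imp_bij_inv)
  moreover have "inv_into UNIV \<phi> \<otimes>\<^bsub>Aut3\<^esub> \<phi> = \<one>\<^bsub>Aut3\<^esub>"
    using bij by (simp add: Aut3_def bij_def)
  ultimately show "\<exists>\<psi>\<in>carrier Aut3. \<psi> \<otimes>\<^bsub>Aut3\<^esub> \<phi> = \<one>\<^bsub>Aut3\<^esub>" by blast
qed (auto simp: Aut3_def pol_algebra_hom_def bij_comp o_assoc)


subsection \<open>Locally nilpotent derivations and their exponentials\<close>

definition exp_term :: "('k::field_char_0 pol3 \<Rightarrow> 'k pol3) \<Rightarrow> nat \<Rightarrow> 'k pol3 \<Rightarrow> 'k pol3" where
  "exp_term D n h = pconst (1 / fact n) * (D ^^ n) h"

context
  fixes D :: "'k::field_char_0 pol3 \<Rightarrow> 'k pol3"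
  assumes der: "pol_derivation D"
begin

lemma der_add: "D (p + q) = D p + D q"
  and der_mult: "D (p * q) = D p * q + p * D q"
  and der_pconst: "D (pconst c) = 0"
  using der by (simp_all add: pol_derivation_def)

lemma der_0: "D 0 = 0"
  using der_pconst[of 0] by simp

lemma der_pow_0: "(D ^^ n) 0 = 0"
  by (induction n) (simp_all add: der_0)

lemma der_pow_add: "(D ^^ n) (p + q) = (D ^^ n) p + (D ^^ n) q"
  by (induction n) (simp_all add: der_add)

lemma der_pow_cmult: "(D ^^ n) (pconst c * p) = pconst c * (D ^^ n) p"
  by (induction n) (simp_all add: der_mult der_pconst)

lemma der_sum: "D (\<Sum>x\<in>A. F x) = (\<Sum>x\<in>A. D (F x))"
  by (induction A rule: infinite_finite_induct) (simp_all add: der_0 der_add)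

lemma der_pow_sum: "(D ^^ n) (\<Sum>x\<in>A. F x) = (\<Sum>x\<in>A. (D ^^ n) (F x))"
  by (induction A rule: infinite_finite_induct) (simp_all add: der_pow_0 der_pow_add)

lemma der_pow_vanish: "(D ^^ l) h = 0 \<Longrightarrow> l \<le> n \<Longrightarrow> (D ^^ n) h = 0"
proof -
  assume "(D ^^ l) h = 0" "l \<le> n"
  then have "(D ^^ (n - l + l)) h = 0"
    by (simp only: funpow_add comp_apply der_pow_0)
  then show ?thesis using \<open>l \<le> n\<close> by simp
qed

lemma der_exp_term: "D (exp_term D n h) = of_nat (Suc n) * exp_term D (Suc n) h"
proof -
  have "of_nat (Suc n) * exp_term D (Suc n) h
      = pconst (of_nat (Suc n) * (1 / fact (Suc n))) * (D ^^ Suc n) h"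
    by (simp only: exp_term_def pconst_mult pconst_of_nat mult.assoc)
  also have "of_nat (Suc n) * (1 / fact (Suc n)) = (1 / fact n :: 'k)"
    by (simp add: fact_Suc del: of_nat_Suc)
  finally have "of_nat (Suc n) * exp_term D (Suc n) h = D (exp_term D n h)"
    unfolding exp_term_def der_mult der_pconst by simp
  then show ?thesis ..
qed

lemma exp_term_mult:
  "exp_term D n (p * q) = (\<Sum>i\<le>n. exp_term D i p * exp_term D (n - i) q)"
proof (induction n)
  case 0
  show ?case by (simp add: exp_term_def)
next
  case (Suc n)
  let ?a = "\<lambda>i. exp_term D i p" and ?b = "\<lambda>i. exp_term D i q"
  have "of_nat (Suc n) * exp_term D (Suc n) (p * q) = D (exp_term D n (p * q))"
    by (simp only: der_exp_term)
  also have "\<dots> = (\<Sum>i\<le>n. of_nat (Suc i) * (?a (Suc i) * ?b (n - i)))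
                 + (\<Sum>i\<le>n. of_nat (Suc (n - i)) * (?a i * ?b (Suc (n - i))))"
    by (simp only: Suc der_sum der_mult der_exp_term sum.distrib mult_ac)
  also have "(\<Sum>i\<le>n. of_nat (Suc i) * (?a (Suc i) * ?b (n - i)))
      = (\<Sum>i\<le>Suc n. of_nat i * (?a i * ?b (Suc n - i)))"
    by (subst sum.atMost_Suc_shift) simp
  also have "(\<Sum>i\<le>n. of_nat (Suc (n - i)) * (?a i * ?b (Suc (n - i))))
      = (\<Sum>i\<le>Suc n. of_nat (Suc n - i) * (?a i * ?b (Suc n - i)))"
    by (auto simp: Suc_diff_le intro!: sum.cong)
  also have "(\<Sum>i\<le>Suc n. of_nat i * (?a i * ?b (Suc n - i)))
      + (\<Sum>i\<le>Suc n. of_nat (Suc n - i) * (?a i * ?b (Suc n - i)))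
      = (\<Sum>i\<le>Suc n. of_nat (Suc n) * (?a i * ?b (Suc n - i)))"
    unfolding sum.distrib[symmetric]
    by (intro sum.cong refl) (simp only: distrib_right[symmetric] of_nat_add[symmetric], simp)
  also have "\<dots> = of_nat (Suc n) * (\<Sum>i\<le>Suc n. ?a i * ?b (Suc n - i))"
    by (simp only: sum_distrib_left)
  finally have eq: "of_nat (Suc n) * exp_term D (Suc n) (p * q)
      = of_nat (Suc n) * (\<Sum>i\<le>Suc n. ?a i * ?b (Suc n - i))" .
  have canc: "pconst (1 / of_nat (Suc n)) * (of_nat (Suc n) * x) = x" for x :: "'k pol3"
  proof -
    have "pconst (1 / of_nat (Suc n)) * (of_nat (Suc n) * x)
        = pconst (1 / of_nat (Suc n) * of_nat (Suc n)) * x"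
      by (simp only: pconst_mult pconst_of_nat mult.assoc)
    then show ?thesis by (simp del: of_nat_Suc)
  qed
  from arg_cong[OF eq, of "\<lambda>x. pconst (1 / of_nat (Suc n)) * x"] show ?case
    by (simp only: canc)
qed

lemma exp_term_vanish: "(D ^^ l) h = 0 \<Longrightarrow> l \<le> n \<Longrightarrow> exp_term D n h = 0"
  by (simp add: exp_term_def der_pow_vanish)

lemma der_pow_eq_exp_term: "(D ^^ n) h = 0 \<longleftrightarrow> exp_term D n h = 0"
proof
  assume "exp_term D n h = 0"
  then have "pconst (fact n) * (pconst (1 / fact n) * (D ^^ n) h) = 0"
    by (simp add: exp_term_def)
  then show "(D ^^ n) h = 0"
    by (simp add: mult.assoc[symmetric] pconst_mult[symmetric])
qed (simp add: exp_term_def)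

lemma nilp_pconst: "\<exists>l. (D ^^ l) (pconst c) = 0"
  using der_pconst[of c] by (intro exI[of _ 1]) simp

lemma nilp_add:
  assumes "\<exists>l. (D ^^ l) p = 0" "\<exists>l. (D ^^ l) q = 0"
  shows "\<exists>l. (D ^^ l) (p + q) = 0"
proof -
  from assms obtain l m where "(D ^^ l) p = 0" "(D ^^ m) q = 0" by blast
  then have "(D ^^ (l + m)) p = 0" "(D ^^ (l + m)) q = 0"
    by (auto intro: der_pow_vanish)
  then have "(D ^^ (l + m)) (p + q) = 0" by (simp add: der_pow_add)
  then show ?thesis ..
qed

lemma nilp_mult:
  assumes "\<exists>l. (D ^^ l) p = 0" "\<exists>l. (D ^^ l) q = 0"
  shows "\<exists>l. (D ^^ l) (p * q) = 0"
proof -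
  from assms obtain l m where lm: "(D ^^ l) p = 0" "(D ^^ m) q = 0" by blast
  have van: "exp_term D i p * exp_term D (l + m - i) q = 0" for i
  proof (cases "l \<le> i")
    case True
    then show ?thesis using exp_term_vanish[OF lm(1)] by simp
  next
    case False
    then have "m \<le> l + m - i" by simp
    then show ?thesis using exp_term_vanish[OF lm(2)] by simp
  qed
  have "exp_term D (l + m) (p * q) = 0" unfolding exp_term_mult van by simp
  then show ?thesis using der_pow_eq_exp_term by blast
qed

lemma nilp_if_der:
  assumes "\<exists>l. (D ^^ l) (D h) = 0"
  shows "\<exists>l. (D ^^ l) h = 0"
proof -
  from assms obtain l where "(D ^^ l) (D h) = 0" ..
  then have "(D ^^ Suc l) h = 0" by (simp only: funpow_Suc_right comp_apply)
  then show ?thesis ..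
qed

lemma locally_nilpotent_if_on_pvars:
  assumes "\<And>i. \<exists>l. (D ^^ l) (pvar i) = 0"
  shows "locally_nilpotent D"
  unfolding locally_nilpotent_def
proof
  fix h
  have "\<exists>l. (D ^^ l) h = 0"
    by (induction h rule: pol_induct) (intro assms nilp_pconst nilp_add nilp_mult; assumption)+
  then obtain l where "(D ^^ l) h = 0" ..
  then have "(D ^^ Suc l) h = 0" by (simp add: der_0)
  then show "\<exists>l\<ge>1. (D ^^ l) h = 0" by (intro exI[of _ "Suc l"]) simp
qed

lemma exp_derivation_eq:
  assumes "(D ^^ l) h = 0"
  shows "exp_derivation D h = (\<Sum>i<l. exp_term D i h)"
  unfolding exp_derivation_def exp_term_def[symmetric]
proof (rule Sum_any.expand_superset)
  show "{i. exp_term D i h \<noteq> 0} \<subseteq> {..<l}"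
    using exp_term_vanish[OF assms] by (auto simp: not_le[symmetric])
qed simp

end

lemma sum_convolution:
  fixes F :: "nat \<Rightarrow> nat \<Rightarrow> 'a::comm_monoid_add"
  assumes van: "\<And>i j. l \<le> i \<or> m \<le> j \<Longrightarrow> F i j = 0"
  shows "(\<Sum>n<l + m. \<Sum>i\<le>n. F i (n - i)) = (\<Sum>i<l. \<Sum>j<m. F i j)"
proof -
  have "(\<Sum>n<l + m. \<Sum>i\<le>n. F i (n - i)) = (\<Sum>(i,j)\<in>{(i,j). i + j < l + m}. F i j)"
    by (simp add: sum.triangle_reindex)
  also have "\<dots> = (\<Sum>(i,j)\<in>{..<l} \<times> {..<m}. F i j)"
  proof (rule sum.mono_neutral_right)
    show "finite {(i, j). i + j < l + m}"
      by (rule finite_subset[of _ "{..<l + m} \<times> {..<l + m}"]) auto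
    show "\<forall>x\<in>{(i, j). i + j < l + m} - {..<l} \<times> {..<m}. (case x of (i, j) \<Rightarrow> F i j) = 0"
      using van by (force simp: not_less)
    show "{..<l} \<times> {..<m} \<subseteq> {(i, j). i + j < l + m}"
      by auto
  qed
  finally show ?thesis by (simp add: sum.cartesian_product)
qed

lemma exp_derivation_mult:
  assumes "pol_derivation D" "locally_nilpotent D"
  shows "exp_derivation D (p * q) = exp_derivation D p * exp_derivation D q"
proof -
  obtain l m where l: "(D ^^ l) p = 0" and m: "(D ^^ m) q = 0"
    using assms(2) unfolding locally_nilpotent_def by meson
  let ?F = "\<lambda>i j. exp_term D i p * exp_term D j q"
  have van: "?F i j = 0" if "l \<le> i \<or> m \<le> j" for i j
    using that exp_term_vanish[OF assms(1) l] exp_term_vanish[OF assms(1) m] by auto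
  have "exp_term D (l + m) (p * q) = 0"
    unfolding exp_term_mult[OF assms(1)]
  proof (intro sum.neutral ballI)
    fix i
    have "l \<le> i \<or> m \<le> l + m - i" by linarith
    then show "?F i (l + m - i) = 0" by (rule van)
  qed
  then have "(D ^^ (l + m)) (p * q) = 0" by (simp add: der_pow_eq_exp_term[OF assms(1)])
  then have "exp_derivation D (p * q) = (\<Sum>n<l + m. \<Sum>i\<le>n. ?F i (n - i))"
    by (simp add: exp_derivation_eq[OF assms(1)] exp_term_mult[OF assms(1)])
  also have "\<dots> = (\<Sum>i<l. \<Sum>j<m. ?F i j)"
    using van by (rule sum_convolution)
  also have "\<dots> = exp_derivation D p * exp_derivation D q"
    by (simp add: exp_derivation_eq[OF assms(1) l] exp_derivation_eq[OF assms(1) m] sum_product)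
  finally show ?thesis .
qed

lemma exp_derivation_hom:
  assumes "pol_derivation D" "locally_nilpotent D"
  shows "pol_algebra_hom (exp_derivation D)"
  unfolding pol_algebra_hom_def
proof (intro conjI allI)
  fix p q
  obtain l m where l: "(D ^^ l) p = 0" and m: "(D ^^ m) q = 0"
    using assms(2) unfolding locally_nilpotent_def by meson
  have "(D ^^ (l + m)) p = 0" "(D ^^ (l + m)) q = 0" "(D ^^ (l + m)) (p + q) = 0"
    using l m by (simp_all add: der_pow_add[OF assms(1)] der_pow_vanish[OF assms(1)])
  note n = this[THEN exp_derivation_eq[OF assms(1)]]
  show "exp_derivation D (p + q) = exp_derivation D p + exp_derivation D q"
    unfolding n exp_term_def der_pow_add[OF assms(1)] distrib_left sum.distrib ..
next
  fix p q
  show "exp_derivation D (p * q) = exp_derivation D p * exp_derivation D q"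
    using assms by (rule exp_derivation_mult)
next
  fix c
  have "(D ^^ 1) (pconst c) = 0" using der_pconst[OF assms(1)] by simp
  from exp_derivation_eq[OF assms(1) this] show "exp_derivation D (pconst c) = pconst c"
    by (simp add: exp_term_def)
qed

lemma uminus_derivation:
  fixes D :: "'k::field_char_0 pol3 \<Rightarrow> 'k pol3"
  assumes "pol_derivation D"
  shows "pol_derivation (\<lambda>h. - D h)"
    and "((\<lambda>h. - D h) ^^ n) h = (-1) ^ n * (D ^^ n) h"
proof -
  show "pol_derivation (\<lambda>h. - D h)"
    using assms by (simp add: pol_derivation_def)
  have "D ((-1) ^ n * h) = (-1) ^ n * D h" for n h
  proof -
    have "((-1) ^ n :: 'k pol3) = pconst ((-1) ^ n)"
      by (induction n) (simp_all add: pconst_mult pconst_uminus)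
    then show ?thesis by (simp add: der_mult[OF assms] der_pconst[OF assms])
  qed
  then show "((\<lambda>h. - D h) ^^ n) h = (-1) ^ n * (D ^^ n) h"
    by (induction n) simp_all
qed

lemma exp_derivation_uminus:
  fixes D :: "'k::field_char_0 pol3 \<Rightarrow> 'k pol3"
  assumes der: "pol_derivation D" and nil: "locally_nilpotent D"
  shows "exp_derivation (\<lambda>h. - D h) (exp_derivation D h) = h"
proof -
  let ?E = "\<lambda>h. - D h"
  note derE = uminus_derivation(1)[OF der] and powE = uminus_derivation(2)[OF der]
  obtain l where "l \<ge> 1" and l: "(D ^^ l) h = 0"
    using nil unfolding locally_nilpotent_def by meson
  let ?F = "\<lambda>i j. exp_term ?E i (exp_term D j h)"
  have F: "?F i j = pconst ((-1) ^ i / (fact i * fact j)) * (D ^^ (i + j)) h" for i j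
  proof -
    have s: "((-1) ^ i :: 'k pol3) = pconst ((-1) ^ i)"
      by (induction i) (simp_all add: pconst_mult pconst_uminus)
    have "?F i j = (pconst (1 / fact i) * pconst ((-1) ^ i) * pconst (1 / fact j))
        * (D ^^ i) ((D ^^ j) h)"
      unfolding exp_term_def powE s der_pow_cmult[OF der] by (simp only: mult_ac)
    also have "(D ^^ i) ((D ^^ j) h) = (D ^^ (i + j)) h" by (simp add: funpow_add)
    also have "pconst (1 / fact i) * pconst ((-1) ^ i) * pconst (1 / fact j)
        = (pconst ((-1) ^ i / (fact i * fact j)) :: 'k pol3)"
      by (simp flip: pconst_mult)
    finally show ?thesis .
  qed
  have van: "?F i j = 0" if "l \<le> i \<or> l \<le> j" for i j
    unfolding F using that by (subst der_pow_vanish[OF der l]) auto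
  have diag: "(\<Sum>i\<le>n. ?F i (n - i)) = (if n = 0 then h else 0)" for n
  proof -
    have "(\<Sum>i\<le>n. ?F i (n - i))
        = (\<Sum>i\<le>n. pconst ((-1) ^ i / (fact i * fact (n - i)))) * (D ^^ n) h"
      unfolding F sum_distrib_right by (intro sum.cong) auto
    also have "(\<Sum>i\<le>n. pconst ((-1) ^ i / (fact i * fact (n - i))))
        = (pconst (\<Sum>i\<le>n. (-1) ^ i / (fact i * fact (n - i))) :: 'k pol3)"
    proof -
      have "pconst (sum G A) = (\<Sum>i\<in>A. pconst (G i))" if "finite A" for G :: "nat \<Rightarrow> 'k" and A
        using that by (induction A) (simp_all add: pconst_add)
      then show ?thesis by simp
    qed
    also have "(\<Sum>i\<le>n. (-1) ^ i / (fact i * fact (n - i)))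
        = (\<Sum>i\<le>n. (-1) ^ i * of_nat (n choose i)) / (fact n :: 'k)"
      unfolding sum_divide_distrib
      by (intro sum.cong) (simp_all add: binomial_fact)
    also have "(\<Sum>i\<le>n. (-1) ^ i * of_nat (n choose i)) = (if n = 0 then 1 else 0 :: 'k)"
      using choose_alternating_sum[of n, where 'a = 'k] by simp
    finally show ?thesis by auto
  qed
  have lE: "(?E ^^ l) (exp_derivation D h) = 0"
  proof -
    have "(D ^^ l) (exp_derivation D h) = 0"
    proof -
      have "(D ^^ l) ((D ^^ j) h) = 0" for j
        using der_pow_vanish[OF der l, of "l + j"] by (simp add: funpow_add)
      then show ?thesis
        by (simp add: exp_derivation_eq[OF der l] der_pow_sum[OF der] exp_term_def
            der_pow_cmult[OF der])
    qed
    then show ?thesis by (simp add: powE)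
  qed
  have "exp_derivation ?E (exp_derivation D h) = (\<Sum>i<l. \<Sum>j<l. ?F i j)"
    unfolding exp_derivation_eq[OF derE lE]
    unfolding exp_derivation_eq[OF der l] exp_term_def der_pow_sum[OF derE] sum_distrib_left ..
  also have "\<dots> = (\<Sum>n<l + l. \<Sum>i\<le>n. ?F i (n - i))"
    using van by (rule sum_convolution[symmetric])
  also have "\<dots> = h"
    using \<open>l \<ge> 1\<close> by (simp add: diag)
  finally show ?thesis .
qed

lemma exp_derivation_Aut3:
  fixes D :: "'k::field_char_0 pol3 \<Rightarrow> 'k pol3"
  assumes der: "pol_derivation D" and nil: "locally_nilpotent D"
  shows "exp_derivation D \<in> carrier Aut3"
proof -
  let ?E = "\<lambda>h. - D h"
  have derE: "pol_derivation ?E" by (rule uminus_derivation(1)[OF der])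
  have nilE: "locally_nilpotent ?E"
    using nil by (simp add: locally_nilpotent_def uminus_derivation(2)[OF der])
  have "bij (exp_derivation D)"
  proof (rule o_bij)
    show "exp_derivation ?E \<circ> exp_derivation D = id"
      using exp_derivation_uminus[OF der nil] by (simp add: fun_eq_iff)
    show "exp_derivation D \<circ> exp_derivation ?E = id"
      using exp_derivation_uminus[OF derE nilE] by (simp add: fun_eq_iff)
  qed
  then show ?thesis by (simp add: Aut3_def exp_derivation_hom[OF der nil])
qed


subsection \<open>The Jacobian derivation of \<open>f\<close> and \<open>g\<close>\<close>

context
  fixes f g r :: "'k::field_char_0 pol3" and \<Delta> :: "'k pol3 \<Rightarrow> 'k pol3"
  assumes f: "f = pvar 1 * pvar 3 - (pvar 2)\<^sup>2"
    and g: "g = pvar 3 * f\<^sup>2 + 2 * pvar 1 * pvar 2 * f + (pvar 1) ^ 3"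
    and r: "r = pvar 2 * f + (pvar 1)\<^sup>2"
    and Delta: "\<Delta> = jacobian_derivation f g"
begin

lemma Delta_derivation: "pol_derivation \<Delta>"
  unfolding Delta by (rule pol_derivation_jacobian)

lemma Delta_values:
  "\<Delta> (pvar 1) = - 2 * r * f"
  "\<Delta> (pvar 2) = 4 * pvar 1 * r - g"
  "\<Delta> (pvar 3) = 6 * pvar 2 * r + 2 * f\<^sup>2"
  "\<Delta> f = 0" "\<Delta> g = 0" "\<Delta> r = - f * g"
proof -
  let ?x = "pvar 1 :: 'k pol3" and ?y = "pvar 2 :: 'k pol3" and ?z = "pvar 3 :: 'k pol3"
  have df: "pdiff 1 f = ?z" "pdiff 2 f = - 2 * ?y" "pdiff 3 f = ?x"
    by (simp_all add: f pdiff_simps power2_eq_square)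
  have dg: "pdiff 1 g = 2 * ?z * f * ?z + 2 * ?y * f + 2 * ?x * ?y * ?z + 3 * ?x\<^sup>2"
    "pdiff 2 g = - 4 * ?z * f * ?y + 2 * ?x * f - 4 * ?x * ?y\<^sup>2"
    "pdiff 3 g = f\<^sup>2 + 2 * ?z * f * ?x + 2 * ?x\<^sup>2 * ?y"
    unfolding g
    by (simp_all add: pdiff_simps df power2_eq_square power3_eq_cube algebra_simps)
  show 1: "\<Delta> (pvar 1) = - 2 * r * f"
    unfolding Delta jacobian_derivation_eq df dg pdiff_pvar
    unfolding r g f
    by (simp add: algebra_simps power2_eq_square power3_eq_cube)
  show 2: "\<Delta> (pvar 2) = 4 * pvar 1 * r - g"
    unfolding Delta jacobian_derivation_eq df dg pdiff_pvar
    unfolding r g f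
    by (simp add: algebra_simps power2_eq_square power3_eq_cube)
  show 3: "\<Delta> (pvar 3) = 6 * pvar 2 * r + 2 * f\<^sup>2"
    unfolding Delta jacobian_derivation_eq df dg pdiff_pvar
    unfolding r g f
    by (simp add: algebra_simps power2_eq_square power3_eq_cube)
  show 4: "\<Delta> f = 0" "\<Delta> g = 0"
    by (simp_all add: Delta jacobian_derivation_eq algebra_simps)
  have "\<Delta> r = \<Delta> ?y * f + ?y * \<Delta> f + 2 * ?x * \<Delta> ?x"
    unfolding r power2_eq_square der_add[OF Delta_derivation] der_mult[OF Delta_derivation]
    by (simp add: algebra_simps)
  then show "\<Delta> r = - f * g"
    unfolding 1 2 4 by (simp add: algebra_simps)
qed

lemma Delta_locally_nilpotent: "locally_nilpotent \<Delta>"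
proof (rule locally_nilpotent_if_on_pvars[OF Delta_derivation])
  note add = nilp_add[OF Delta_derivation] and mult = nilp_mult[OF Delta_derivation]
    and const = nilp_pconst[OF Delta_derivation] and der = nilp_if_der[OF Delta_derivation]
  have zero: "\<exists>l. (\<Delta> ^^ l) 0 = 0" by (rule exI[of _ 0]) simp
  have minus: "\<exists>l. (\<Delta> ^^ l) (- p) = 0" if "\<exists>l. (\<Delta> ^^ l) p = 0" for p
    using mult[OF const[of "-1"] that] by (simp add: pconst_uminus)
  have num: "\<exists>l. (\<Delta> ^^ l) (numeral n) = 0" for n
    using const[of "numeral n"] by (simp add: pconst_def)
  have F: "\<exists>l. (\<Delta> ^^ l) f = 0" by (rule der) (simp only: Delta_values zero)
  have G: "\<exists>l. (\<Delta> ^^ l) g = 0" by (rule der) (simp only: Delta_values zero)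
  have R: "\<exists>l. (\<Delta> ^^ l) r = 0"
    by (rule der, unfold Delta_values) (intro mult minus F G)
  have 1: "\<exists>l. (\<Delta> ^^ l) (pvar 1) = 0"
    by (rule der, unfold Delta_values) (intro mult minus num F R)
  have 2: "\<exists>l. (\<Delta> ^^ l) (pvar 2) = 0"
    by (rule der, unfold Delta_values diff_conv_add_uminus) (intro add mult minus num 1 R G)
  have 3: "\<exists>l. (\<Delta> ^^ l) (pvar 3) = 0"
    by (rule der, unfold Delta_values power2_eq_square) (intro add mult num 2 R F)
  show "\<exists>l. (\<Delta> ^^ l) (pvar i) = 0" for i
    using 1 2 3 exhaust_3[of i] by metis
qed

lemma exp_Delta_Aut3: "exp_derivation \<Delta> \<in> carrier Aut3"
  using Delta_derivation Delta_locally_nilpotent by (rule exp_derivation_Aut3)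

end

end

theory Submission
  imports Defs "HOL-Computational_Algebra.Polynomial"
begin

text \<open>
  Write \<open>d\<close> for the total degree and \<open>E\<^sub>c = exp (c\<Delta>)\<close>, so that \<open>E\<^sub>c\<close> fixes \<open>f\<close> and \<open>g\<close> and
  maps \<open>r\<close> to \<open>r - c f g\<close>. For an endomorphism \<open>\<psi>\<close> put \<open>F = d (\<psi> f)\<close>, \<open>G = d (\<psi> g)\<close>,
  \<open>R = d (\<psi> r)\<close>. If \<open>R < F + G\<close>, then composing with \<open>E\<^sub>c\<close>, \<open>c \<noteq> 0\<close>, yields \<open>R = F + G\<close>; by
  \<open>x\<^sub>1 g = r\<^sup>2 + f\<^sup>3\<close>, \<open>x\<^sub>2 f = r - x\<^sub>1\<^sup>2\<close> and \<open>x\<^sub>3 f\<^sup>2 = g - 2 x\<^sub>1 r + x\<^sub>1\<^sup>3\<close> the images of the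
  variables then have the distinct degrees \<open>2F + G\<close>, \<open>3F + 2G\<close>, \<open>4F + 3G\<close>, and a leading term
  analysis shows that composing with any affine map outside the torus
  \<open>(s\<^sup>3 x\<^sub>1, s\<^sup>2 x\<^sub>2, s x\<^sub>3)\<close> restores \<open>R < F + G\<close>. The torus normalises the \<open>E\<^sub>c\<close>, so every
  element of \<open>\<langle>\<phi>, Aff\<^sub>3\<rangle>\<close> is affine or, up to affine maps on both sides, has degree at least 7.
  The quadratic automorphism \<open>(x\<^sub>1, x\<^sub>2, x\<^sub>3 + x\<^sub>1\<^sup>2)\<close> is neither.
\<close>

subsection \<open>Degree maps\<close>

locale degree_map =
  fixes d :: "'a::idom \<Rightarrow> nat"
  assumes d_0: "d 0 = 0"
    and d_mult: "x \<noteq> 0 \<Longrightarrow> y \<noteq> 0 \<Longrightarrow> d (x * y) = d x + d y"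
    and d_add: "d (x + y) \<le> max (d x) (d y)"
    and two_neq_0: "(2::'a) \<noteq> 0"
begin

text \<open>The convention \<open>d 0 = 0\<close> does not separate zero from nonzero constants, so
  exact degrees carry nonvanishing along.\<close>

definition dg :: "'a \<Rightarrow> nat \<Rightarrow> bool" where
  "dg x n \<longleftrightarrow> x \<noteq> 0 \<and> d x = n"

lemma d_1: "d 1 = 0"
  using d_mult[of 1 1] by simp

lemma d_uminus: "d (- x) = d x"
proof (cases "x = 0")
  case False
  have "d (- 1) = 0" using d_mult[of "-1" "-1"] d_1 by simp
  then show ?thesis using d_mult[of "-1" x] False by simp
qed simp

lemma d_2: "d 2 = 0"
  using d_add[of 1 1] d_1 by simp

lemma d_mult_le: "d (x * y) \<le> d x + d y"
  using d_mult[of x y] d_0 by (cases "x = 0 \<or> y = 0") auto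

lemma d_add_le: "d x \<le> n \<Longrightarrow> d y \<le> n \<Longrightarrow> d (x + y) \<le> n"
  using d_add[of x y] by simp

lemma d_diff_le: "d x \<le> n \<Longrightarrow> d y \<le> n \<Longrightarrow> d (x - y) \<le> n"
  using d_add[of x "- y"] d_uminus[of y] by simp

lemma d_add_less: "d x < n \<Longrightarrow> d y < n \<Longrightarrow> d (x + y) < n"
  using d_add[of x y] by simp

lemma d_diff_less: "d x < n \<Longrightarrow> d y < n \<Longrightarrow> d (x - y) < n"
  using d_add[of x "- y"] d_uminus[of y] by simp

lemma d_cmult_le: "d c = 0 \<Longrightarrow> d x \<le> n \<Longrightarrow> d (c * x) \<le> n"
  using d_mult_le[of c x] by simp

lemma d_cmult_less: "d c = 0 \<Longrightarrow> d x < n \<Longrightarrow> d (c * x) < n"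
  using d_mult_le[of c x] by simp

lemma d_2mult_less: "d x < n \<Longrightarrow> d (2 * x) < n"
  using d_cmult_less[OF d_2] .

lemma d_power_le: "d (x ^ n) \<le> n * d x"
proof (induction n)
  case (Suc n)
  then show ?case using d_mult_le[of x "x ^ n"] by simp
qed (simp add: d_1)

lemma dg_mult: "dg x m \<Longrightarrow> dg y n \<Longrightarrow> dg (x * y) (m + n)"
  by (simp add: dg_def d_mult)

lemma dg_power: "dg x m \<Longrightarrow> dg (x ^ n) (n * m)"
  by (induction n) (simp_all add: dg_def d_mult d_1)

lemma dg_cmult: "c \<noteq> 0 \<Longrightarrow> d c = 0 \<Longrightarrow> dg x n \<Longrightarrow> dg (c * x) n"
  by (simp add: dg_def d_mult)

lemma dg_uminus: "dg x n \<Longrightarrow> dg (- x) n"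
  by (simp add: dg_def d_uminus)

lemma dg_add: assumes "dg x n" "d y < n" shows "dg (x + y) n"
proof -
  have "d (x + y) \<le> n" using assms d_add[of x y] by (simp add: dg_def)
  \<comment> \<open>Writing \<open>x\<close> as \<open>(x + y) - y\<close> bounds the sum from
    below; \<open>d y < n\<close> also makes \<open>n\<close> positive, which excludes
    \<open>x + y = 0\<close>.\<close>
  moreover have "n \<le> max (d (x + y)) (d y)"
    using assms d_add[of "x + y" "- y"] d_uminus[of y] by (simp add: dg_def)
  ultimately have "d (x + y) = n" using assms by auto
  then show ?thesis using assms d_0 by (auto simp: dg_def)
qed

lemma dg_cancel: assumes "dg (x * y) n" "dg y m" shows "\<exists>k. dg x k \<and> k + m = n"
  using assms by (auto simp: dg_def d_mult)

lemma dg_d: "dg x n \<Longrightarrow> d x = n"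
  by (simp add: dg_def)

end

subsection \<open>The polynomials \<open>f\<close>, \<open>g\<close>, \<open>r\<close> under affine substitutions\<close>

definition form_f :: "'a::comm_ring_1 \<Rightarrow> 'a \<Rightarrow> 'a \<Rightarrow> 'a" where
  "form_f x y z = x * z - y\<^sup>2"

definition form_r :: "'a::comm_ring_1 \<Rightarrow> 'a \<Rightarrow> 'a \<Rightarrow> 'a" where
  "form_r x y z = y * form_f x y z + x\<^sup>2"

definition form_g :: "'a::comm_ring_1 \<Rightarrow> 'a \<Rightarrow> 'a \<Rightarrow> 'a" where
  "form_g x y z = z * (form_f x y z)\<^sup>2 + 2 * x * y * form_f x y z + x ^ 3"

text \<open>These identities recover \<open>x\<close>, \<open>y\<close>, \<open>z\<close> from the
  values of f, g, r by successive division; the degree formulas and the uniqueness of homomorphisms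
  rest on them.\<close>

lemma form_relations:
  "x * form_g x y z = (form_r x y z)\<^sup>2 + form_f x y z ^ 3"
  "y * form_f x y z = form_r x y z - x\<^sup>2"
  "z * (form_f x y z)\<^sup>2 = form_g x y z - 2 * x * form_r x y z + x ^ 3"
  unfolding form_g_def form_r_def form_f_def
  by (simp_all add: algebra_simps power2_eq_square power3_eq_cube)

section \<open>Degree conditions before and after a flow step\<close>

context degree_map
begin

text \<open>\<open>F < 2 * G\<close> means \<open>3 * F < 2 * (F + G)\<close>: once r has degree
  \<open>F + G\<close>, its square outweighs the cube of f in the first of
  \<open>form_relations\<close>.\<close>

definition pre_state :: "'a \<Rightarrow> 'a \<Rightarrow> 'a \<Rightarrow> bool" where
  "pre_state x y z \<longleftrightarrow> (\<exists>F G. dg (form_f x y z) F \<and> dg (form_g x y z) G \<and>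
     d (form_r x y z) < F + G \<and> 1 \<le> F \<and> 1 \<le> G \<and> F < 2 * G)"

definition post_state :: "'a \<Rightarrow> 'a \<Rightarrow> 'a \<Rightarrow> nat \<Rightarrow> nat \<Rightarrow> bool" where
  "post_state x y z F G \<longleftrightarrow> dg (form_f x y z) F \<and> dg (form_g x y z) G \<and>
     dg (form_r x y z) (F + G) \<and> 1 \<le> F \<and> 1 \<le> G \<and> F < 2 * G"

text \<open>On the right sides of \<open>form_relations\<close> the square of r, then
  \<open>- (x\<^sup>2)\<close>, then \<open>x ^ 3\<close> strictly dominates; cancelling the known
  factor on the left gives each degree.\<close>

lemma post_state_degrees:
  assumes "post_state x y z F G"
  shows "dg x (2 * F + G)" "dg y (3 * F + 2 * G)" "dg z (4 * F + 3 * G)"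
proof -
  let ?f = "form_f x y z" and ?g = "form_g x y z" and ?r = "form_r x y z"
  have *: "dg ?f F" "dg ?g G" "dg ?r (F + G)" "1 \<le> F" "1 \<le> G" "F < 2 * G"
    using assms by (auto simp: post_state_def)
  have "dg (?r\<^sup>2 + ?f ^ 3) (2 * (F + G))"
    by (rule dg_add[OF dg_power[OF *(3)]]) (use dg_power[OF *(1), of 3] * in \<open>auto simp: dg_def\<close>)
  then show x: "dg x (2 * F + G)"
    using dg_cancel[of x ?g "2 * (F + G)" G] * by (auto simp: form_relations(1) algebra_simps)
  have "dg (- (x\<^sup>2) + ?r) (2 * (2 * F + G))"
    by (rule dg_add[OF dg_uminus[OF dg_power[OF x]]]) (use * in \<open>auto simp: dg_def\<close>)
  then have "dg (y * ?f) (2 * (2 * F + G))" by (simp add: form_relations(2))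
  from dg_cancel[OF this *(1)] show "dg y (3 * F + 2 * G)"
    by (auto simp: algebra_simps)
  have "dg (x ^ 3 + (?g - 2 * (x * ?r))) (3 * (2 * F + G))"
  proof (rule dg_add[OF dg_power[OF x]])
    have "d (x * ?r) = 3 * F + 2 * G" using dg_mult[OF x *(3)] by (simp add: dg_def)
    then show "d (?g - 2 * (x * ?r)) < 3 * (2 * F + G)"
      by (intro d_diff_less d_2mult_less) (use * in \<open>auto simp: dg_def\<close>)
  qed
  then have "dg (z * ?f\<^sup>2) (3 * (2 * F + G))" by (simp add: form_relations(3) algebra_simps)
  from dg_cancel[OF this dg_power[OF *(1)]] show "dg z (4 * F + 3 * G)"
    by (auto simp: algebra_simps)
qed

text \<open>The bounds in \<open>D\<close> make \<open>v3 * ?f\<^sup>2\<close> outweigh the other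
  two terms of g, so \<open>G\<close> is \<open>D3 + 2 * F'\<close>, and they keep r below
  \<open>F' + G\<close>.\<close>

lemma pre_state_if_f_dominates:
  assumes f: "dg (form_f v1 v2 v3) F'" and "1 \<le> F'"
    and v: "d v1 \<le> D1" "d v2 \<le> D2" "dg v3 D3"
    and D: "D1 + D2 < D3 + F'" "3 * D1 < D3 + 2 * F'"
  shows "pre_state v1 v2 v3"
proof -
  let ?f = "form_f v1 v2 v3"
  have b: "d (v1 * v2) \<le> D1 + D2" "d (v1 ^ 3) \<le> 3 * D1" "d (v1\<^sup>2) \<le> 2 * D1"
     "d (v2 * ?f) \<le> D2 + F'" "d ((v1 * v2) * ?f) \<le> D1 + D2 + F'"
    using d_mult_le[of v1 v2] d_power_le[of v1 3] d_power_le[of v1 2] v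
      d_mult_le[of v2 ?f] d_mult_le[of "v1 * v2" ?f] f by (auto simp: dg_def)
  have "dg (v3 * ?f\<^sup>2 + (2 * (v1 * v2 * ?f) + v1 ^ 3)) (D3 + 2 * F')"
    by (rule dg_add[OF dg_mult[OF v(3) dg_power[OF f]]], intro d_add_less d_2mult_less)
       (use b D in linarith)+
  then have "dg (form_g v1 v2 v3) (D3 + 2 * F')" by (simp add: form_g_def algebra_simps)
  moreover have "d (form_r v1 v2 v3) < F' + (D3 + 2 * F')"
    unfolding form_r_def by (intro d_add_less) (use b D in linarith)+
  ultimately show ?thesis
    unfolding pre_state_def using f \<open>1 \<le> F'\<close>
    by (intro exI[of _ F'] exI[of _ "D3 + 2 * F'"]) auto
qed

text \<open>Here \<open>v1 ^ 3\<close> leads in g: the bounds push both terms containing f below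
  \<open>3 * D1\<close>.\<close>

lemma pre_state_if_v1_dominates:
  assumes f: "dg (form_f v1 v2 v3) F'" and "1 \<le> F'"
    and v: "dg v1 D1" "d v2 \<le> D2" "d v3 \<le> D3"
    and D: "D3 + 2 * F' < 3 * D1" "D2 + F' < 2 * D1"
  shows "pre_state v1 v2 v3"
proof -
  let ?f = "form_f v1 v2 v3"
  have b: "d (v1 * v2) \<le> D1 + D2" "d (v1\<^sup>2) \<le> 2 * D1" "d (v3 * ?f\<^sup>2) \<le> D3 + 2 * F'"
     "d (v2 * ?f) \<le> D2 + F'" "d ((v1 * v2) * ?f) \<le> D1 + D2 + F'"
    using d_mult_le[of v1 v2] d_power_le[of v1 2] v dg_power[OF f, of 2] d_mult_le[of v3 "?f\<^sup>2"]
      d_mult_le[of v2 ?f] d_mult_le[of "v1 * v2" ?f] f by (auto simp: dg_def)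
  have "dg (v1 ^ 3 + (2 * (v1 * v2 * ?f) + v3 * ?f\<^sup>2)) (3 * D1)"
    by (rule dg_add[OF dg_power[OF v(1)]], intro d_add_less d_2mult_less)
       (use b D in linarith)+
  then have "dg (form_g v1 v2 v3) (3 * D1)" by (simp add: form_g_def algebra_simps)
  moreover have "d (form_r v1 v2 v3) < F' + 3 * D1"
    unfolding form_r_def by (intro d_add_less) (use b D in linarith)+
  ultimately show ?thesis
    unfolding pre_state_def using f \<open>1 \<le> F'\<close> D
    by (intro exI[of _ F'] exI[of _ "3 * D1"]) auto
qed

text \<open>For \<open>v1\<close> and f of equal degree \<open>n\<close> the terms of g may cancel.
  Its degree is found instead from \<open>v1 * g = r\<^sup>2 + f ^ 3\<close>, where the degrees on
  the right differ, and equals \<open>2 * k - n\<close> or \<open>2 * n\<close>. The second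
  alternative includes r = 0.\<close>

lemma pre_state_via_form_r:
  assumes f: "dg (form_f v1 v2 v3) n" and "1 \<le> n" and v1: "dg v1 n"
    and r: "(\<exists>k. dg (form_r v1 v2 v3) k \<and> 3 * n < 2 * k) \<or> 2 * d (form_r v1 v2 v3) < 3 * n"
  shows "pre_state v1 v2 v3"
proof -
  let ?f = "form_f v1 v2 v3" and ?g = "form_g v1 v2 v3" and ?r = "form_r v1 v2 v3"
  have eq: "?g * v1 = ?r\<^sup>2 + ?f ^ 3" using form_relations(1)[of v1 v2 v3] by (simp add: mult.commute)
  from r show ?thesis
  proof
    assume "\<exists>k. dg ?r k \<and> 3 * n < 2 * k"
    then obtain k where k: "dg ?r k" "3 * n < 2 * k" by blast
    have "dg (?g * v1) (2 * k)"
      unfolding eq by (rule dg_add[OF dg_power[OF k(1)]]) (use dg_power[OF f, of 3] k in \<open>auto simp: dg_def\<close>)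
    from dg_cancel[OF this v1] obtain G where "dg ?g G" "G + n = 2 * k" by blast
    then show ?thesis unfolding pre_state_def using f k \<open>1 \<le> n\<close>
      by (intro exI[of _ n] exI[of _ G]) (auto simp: dg_def)
  next
    assume k: "2 * d ?r < 3 * n"
    have "dg (?g * v1) (3 * n)"
      unfolding eq add.commute[of "?r\<^sup>2"]
      by (rule dg_add[OF dg_power[OF f]]) (use d_power_le[of ?r 2] k in simp)
    from dg_cancel[OF this v1] obtain G where "dg ?g G" "G + n = 3 * n" by blast
    then show ?thesis unfolding pre_state_def using f k \<open>1 \<le> n\<close>
      by (intro exI[of _ n] exI[of _ G]) (auto simp: dg_def)
  qed
qed


text \<open>The first nonzero coefficient decides. The remainder \<open>m4\<close> is only bounded,
  so that one combination can serve as the tail of the next.\<close>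

lemma dg_linear_combination:
  assumes m: "dg m1 n1" "dg m2 n2" "dg m3 n3" "d m4 \<le> n4" and n: "n4 < n3" "n3 < n2" "n2 < n1"
    and c: "d c1 = 0" "d c2 = 0" "d c3 = 0"
  shows "c1 \<noteq> 0 \<Longrightarrow> dg (c1 * m1 + c2 * m2 + c3 * m3 + m4) n1"
    and "c1 = 0 \<Longrightarrow> c2 \<noteq> 0 \<Longrightarrow> dg (c1 * m1 + c2 * m2 + c3 * m3 + m4) n2"
    and "c1 = 0 \<Longrightarrow> c2 = 0 \<Longrightarrow> c3 \<noteq> 0 \<Longrightarrow> dg (c1 * m1 + c2 * m2 + c3 * m3 + m4) n3"
    and "d (c1 * m1 + c2 * m2 + c3 * m3 + m4) \<le> n1"
proof -
  note [simp] = dg_d[OF m(1)] dg_d[OF m(2)] dg_d[OF m(3)] c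
  show "d (c1 * m1 + c2 * m2 + c3 * m3 + m4) \<le> n1"
    by (intro d_add_le d_cmult_le) (use m(4) n in auto)
  assume "c1 \<noteq> 0"
  have "dg (c1 * m1 + (c2 * m2 + c3 * m3 + m4)) n1"
    by (intro dg_add dg_cmult \<open>c1 \<noteq> 0\<close> m d_add_less d_cmult_less) (use m(4) n in auto)
  then show "dg (c1 * m1 + c2 * m2 + c3 * m3 + m4) n1" by (simp add: algebra_simps)
next
  note [simp] = dg_d[OF m(1)] dg_d[OF m(2)] dg_d[OF m(3)] c
  assume "c1 = 0" "c2 \<noteq> 0"
  have "dg (c2 * m2 + (c3 * m3 + m4)) n2"
    by (intro dg_add dg_cmult \<open>c2 \<noteq> 0\<close> m d_add_less d_cmult_less) (use m(4) n in auto)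
  then show "dg (c1 * m1 + c2 * m2 + c3 * m3 + m4) n2"
    using \<open>c1 = 0\<close> by (simp add: algebra_simps)
next
  assume "c1 = 0" "c2 = 0" "c3 \<noteq> 0"
  have "dg (c3 * m3 + m4) n3"
    by (intro dg_add dg_cmult \<open>c3 \<noteq> 0\<close> m c) (use m(4) n in auto)
  then show "dg (c1 * m1 + c2 * m2 + c3 * m3 + m4) n3"
    using \<open>c1 = 0\<close> \<open>c2 = 0\<close> by simp
qed

text \<open>Takes the place of the base field inside an abstract domain; zero is included.\<close>

definition is_const :: "'a \<Rightarrow> bool" where "is_const c \<longleftrightarrow> d c = 0"

lemma is_const_2: "is_const 2" by (simp add: is_const_def d_2)

lemma is_const_add: "is_const x \<Longrightarrow> is_const y \<Longrightarrow> is_const (x + y)"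
  and is_const_diff: "is_const x \<Longrightarrow> is_const y \<Longrightarrow> is_const (x - y)"
  and is_const_mult: "is_const x \<Longrightarrow> is_const y \<Longrightarrow> is_const (x * y)"
  and is_const_power: "is_const x \<Longrightarrow> is_const (x ^ n)"
  using d_add_le[of x 0 y] d_diff_le[of x 0 y] d_mult_le[of x y] d_power_le[of x n]
  by (simp_all add: is_const_def)

lemmas is_const_intros = is_const_2 is_const_add is_const_diff is_const_mult is_const_power

end

section \<open>Affine substitutions into a triple in post state\<close>

locale affine_image = degree_map d for d :: "'a::idom \<Rightarrow> nat" +
  fixes u1 u2 u3 :: 'a and F G :: nat
    and a1 a1' a1'' b1 a2 a2' a2'' b2 a3 a3' a3'' b3 :: 'a
  assumes post: "post_state u1 u2 u3 F G"
    and const: "is_const a1" "is_const a1'" "is_const a1''" "is_const b1"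
      "is_const a2" "is_const a2'" "is_const a2''" "is_const b2"
      "is_const a3" "is_const a3'" "is_const a3''" "is_const b3"
    and det: "a1 * (a2' * a3'' - a2'' * a3') - a1' * (a2 * a3'' - a2'' * a3)
      + a1'' * (a2 * a3' - a2' * a3) \<noteq> 0"
begin

text \<open>Coefficients are listed by descending degree of \<open>u3\<close>, \<open>u2\<close>,
  \<open>u1\<close>, so the first nonzero one decides the degree of the image.\<close>

definition "v1 = a1 * u3 + a1' * u2 + a1'' * u1 + b1"
definition "v2 = a2 * u3 + a2' * u2 + a2'' * u1 + b2"
definition "v3 = a3 * u3 + a3' * u2 + a3'' * u1 + b3"
text \<open>These are the coefficients of \<open>f'\<close> in \<open>f'_eq\<close>, numbered by
  strictly descending degree of the monomials, with \<open>c0\<close> last. The coefficient of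
  \<open>u1 * u3\<close> is \<open>c9\<close>; the elimination also adds it to that of
  \<open>u2\<^sup>2\<close>, which gives \<open>c3\<close>.\<close>

definition "c1 = a1 * a3 - a2\<^sup>2"
definition "c2 = a1 * a3' + a1' * a3 - 2 * a2 * a2'"
definition "c3 = a1 * a3'' + a1'' * a3 - 2 * a2 * a2'' + a1' * a3' - a2'\<^sup>2"
definition "c4 = a1' * a3'' + a1'' * a3' - 2 * a2' * a2''"
definition "c5 = a1 * b3 + a3 * b1 - 2 * a2 * b2"
definition "c6 = a1'' * a3'' - a2''\<^sup>2"
definition "c7 = a1' * b3 + a3' * b1 - 2 * a2' * b2"
definition "c8 = a1'' * b3 + a3'' * b1 - 2 * a2'' * b2"
definition "c9 = a1 * a3'' + a1'' * a3 - 2 * a2 * a2''"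
definition "c0 = b1 * b3 - b2\<^sup>2"

lemmas c_defs = c0_def c1_def c2_def c3_def c4_def c5_def c6_def c7_def c8_def c9_def

abbreviation "f \<equiv> form_f u1 u2 u3"
abbreviation "g \<equiv> form_g u1 u2 u3"
abbreviation "r \<equiv> form_r u1 u2 u3"
abbreviation "f' \<equiv> form_f v1 v2 v3"
abbreviation "g' \<equiv> form_g v1 v2 v3"
abbreviation "r' \<equiv> form_r v1 v2 v3"

lemma c_const: "is_const c0" "is_const c1" "is_const c2" "is_const c3" "is_const c4"
  "is_const c5" "is_const c6" "is_const c7" "is_const c8" "is_const c9"
  unfolding c_defs by (intro is_const_intros const)+

lemma FG: "1 \<le> F" "1 \<le> G" "F < 2 * G"
  and dg_fgr: "dg f F" "dg g G" "dg r (F + G)"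
  using post by (auto simp: post_state_def)

lemmas dg_u = post_state_degrees[OF post]

text \<open>
  Eliminating \<open>u1 * u3 = u2\<^sup>2 + f\<close> leaves monomials of pairwise distinct degrees.
\<close>

lemma f'_eq: "f' = c1 * u3\<^sup>2 + c2 * (u2 * u3) + c3 * u2\<^sup>2
  + (c4 * (u1 * u2) + c5 * u3 + c6 * u1\<^sup>2 + (c7 * u2 + c8 * u1 + c9 * f + c0))"
  unfolding form_f_def v1_def v2_def v3_def c_defs
  by (simp add: algebra_simps power2_eq_square)

text \<open>A nondegenerate quadratic form stays so under an invertible substitution. The identity
  in the proof computes the half-discriminant of the quadratic part of \<open>f'\<close>: it is 1
  for \<open>x * z - y\<^sup>2\<close> and is multiplied by the squared determinant.\<close>

lemma c_zero_contradiction: "\<lbrakk>c1 = 0; c2 = 0; c3 = 0; c4 = 0; c6 = 0; c9 = 0\<rbrakk> \<Longrightarrow> False"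
proof -
  have "4 * c1 * (c3 - c9) * c6 + c2 * c4 * c9 - (c3 - c9) * c9\<^sup>2 - c1 * c4\<^sup>2 - c6 * c2\<^sup>2
    = (a1 * (a2' * a3'' - a2'' * a3') - a1' * (a2 * a3'' - a2'' * a3)
      + a1'' * (a2 * a3' - a2' * a3))\<^sup>2"
    unfolding c_defs by (simp add: algebra_simps power2_eq_square)
  then show "\<lbrakk>c1 = 0; c2 = 0; c3 = 0; c4 = 0; c6 = 0; c9 = 0\<rbrakk> \<Longrightarrow> False"
    using det by simp
qed

text \<open>Walks down the monomials of \<open>f'_eq\<close>. The bottom value \<open>F\<close>
  occurs only for \<open>f' = c9 * f + c0\<close>, where \<open>c9\<close> is nonzero by
  \<open>c_zero_contradiction\<close>.\<close>

lemma f'_degree: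
  shows "c1 \<noteq> 0 \<Longrightarrow> dg f' (8 * F + 6 * G)"
    and "c1 = 0 \<Longrightarrow> c2 \<noteq> 0 \<Longrightarrow> dg f' (7 * F + 5 * G)"
    and "c1 = 0 \<Longrightarrow> c2 = 0 \<Longrightarrow> c3 \<noteq> 0 \<Longrightarrow> dg f' (6 * F + 4 * G)"
    and "c1 = 0 \<Longrightarrow> c2 = 0 \<Longrightarrow> c3 = 0 \<Longrightarrow> c4 \<noteq> 0 \<Longrightarrow> dg f' (5 * F + 3 * G)"
    and "c1 = 0 \<Longrightarrow> c2 = 0 \<Longrightarrow> c3 = 0 \<Longrightarrow> c4 = 0 \<Longrightarrow> c5 \<noteq> 0 \<Longrightarrow> dg f' (4 * F + 3 * G)"
    and "c1 = 0 \<Longrightarrow> c2 = 0 \<Longrightarrow> c3 = 0 \<Longrightarrow> c4 = 0 \<Longrightarrow> c5 = 0 \<Longrightarrow>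
      \<exists>n. dg f' n \<and> F \<le> n \<and> n < 4 * F + 3 * G \<and> (c6 = 0 \<and> c7 = 0 \<and> c8 = 0 \<or> F < n)"
proof -
  note const = c_const[unfolded is_const_def]
  \<comment> \<open>The ten terms form three nested linear combinations, treated from the lowest
    upwards; each is the tail of the next.\<close>
  let ?S = "c7 * u2 + c8 * u1 + c9 * f + c0"
  let ?T = "c4 * (u1 * u2) + c5 * u3 + c6 * u1\<^sup>2 + ?S"
  have "d c0 \<le> 0" using const(1) by simp
  note S = dg_linear_combination[OF dg_u(2,1) dg_fgr(1) this _ _ _ const(8-10)]
  have S1: "d ?S \<le> 3 * F + 2 * G" by (rule S(4)) (use FG in auto)
  have m12: "dg (u1 * u2) (5 * F + 3 * G)" and m11: "dg (u1\<^sup>2) (4 * F + 2 * G)"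
    and m33: "dg (u3\<^sup>2) (8 * F + 6 * G)" and m23: "dg (u2 * u3) (7 * F + 5 * G)"
    and m22: "dg (u2\<^sup>2) (6 * F + 4 * G)"
    using dg_mult[OF dg_u(1,2)] dg_power[OF dg_u(1), of 2] dg_power[OF dg_u(2), of 2]
      dg_power[OF dg_u(3), of 2] dg_mult[OF dg_u(2,3)]
    by (simp_all add: dg_def)
  note T = dg_linear_combination[OF m12 dg_u(3) m11 S1 _ _ _ const(5-7)]
  have T1: "d ?T \<le> 5 * F + 3 * G" by (rule T(4)) (use FG in auto)
  note U = dg_linear_combination[OF m33 m23 m22 T1 _ _ _ const(2-4)]
  show "c1 \<noteq> 0 \<Longrightarrow> dg f' (8 * F + 6 * G)"
    "c1 = 0 \<Longrightarrow> c2 \<noteq> 0 \<Longrightarrow> dg f' (7 * F + 5 * G)"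
    "c1 = 0 \<Longrightarrow> c2 = 0 \<Longrightarrow> c3 \<noteq> 0 \<Longrightarrow> dg f' (6 * F + 4 * G)"
    unfolding f'_eq by (rule U; use FG in simp)+
  show "c1 = 0 \<Longrightarrow> c2 = 0 \<Longrightarrow> c3 = 0 \<Longrightarrow> c4 \<noteq> 0 \<Longrightarrow> dg f' (5 * F + 3 * G)"
    "c1 = 0 \<Longrightarrow> c2 = 0 \<Longrightarrow> c3 = 0 \<Longrightarrow> c4 = 0 \<Longrightarrow> c5 \<noteq> 0 \<Longrightarrow> dg f' (4 * F + 3 * G)"
    using T(1,2) FG unfolding f'_eq by auto
  assume z: "c1 = 0" "c2 = 0" "c3 = 0" "c4 = 0" "c5 = 0"
  show "\<exists>n. dg f' n \<and> F \<le> n \<and> n < 4 * F + 3 * G \<and> (c6 = 0 \<and> c7 = 0 \<and> c8 = 0 \<or> F < n)"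
  proof (cases "c6 = 0")
    case False
    then have "dg f' (4 * F + 2 * G)" using T(3) FG z unfolding f'_eq by auto
    then show ?thesis using FG by (intro exI[of _ "4 * F + 2 * G"]) auto
  next
    case c6: True
    then have f': "f' = ?S" using z unfolding f'_eq by simp
    consider "c7 \<noteq> 0" | "c7 = 0" "c8 \<noteq> 0" | "c7 = 0" "c8 = 0" by blast
    then show ?thesis
    proof cases
      case 1
      then have "dg f' (3 * F + 2 * G)" unfolding f' by (intro S(1)) (use FG in auto)
      then show ?thesis using FG by (intro exI[of _ "3 * F + 2 * G"]) auto
    next
      case 2
      then have "dg f' (2 * F + G)" unfolding f' by (intro S(2)) (use FG in auto)
      then show ?thesis using FG by (intro exI[of _ "2 * F + G"]) auto
    next
      case 3
      moreover have "c9 \<noteq> 0" using c_zero_contradiction z c6 by blast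
      ultimately have "dg f' F" unfolding f' by (intro S(3)) (use FG in auto)
      then show ?thesis using FG 3 c6 by (intro exI[of _ F]) auto
    qed
  qed
qed

lemma v_degree_le: "d v1 \<le> 4 * F + 3 * G" "d v2 \<le> 4 * F + 3 * G" "d v3 \<le> 4 * F + 3 * G"
  unfolding v1_def v2_def v3_def
  by (intro d_add_le d_cmult_le const[unfolded is_const_def];
      use dg_u[THEN dg_d] const[unfolded is_const_def] FG in simp)+

lemma v_degree_le2:
  "a1 = 0 \<Longrightarrow> d v1 \<le> 3 * F + 2 * G" "a2 = 0 \<Longrightarrow> d v2 \<le> 3 * F + 2 * G"
  unfolding v1_def v2_def
  by (simp, intro d_add_le d_cmult_le const[unfolded is_const_def];
      use dg_u[THEN dg_d] const[unfolded is_const_def] FG in simp)+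

lemma v1_degree: "a1 \<noteq> 0 \<Longrightarrow> dg v1 (4 * F + 3 * G)"
  "a1 = 0 \<Longrightarrow> a1' = 0 \<Longrightarrow> dg v1 (2 * F + G)"
proof -
  note const = const[unfolded is_const_def]
  have "d b1 \<le> 0" using const by simp
  note L = dg_linear_combination[OF dg_u(3,2,1) this _ _ _ const(1,2,3), folded v1_def]
  show "a1 \<noteq> 0 \<Longrightarrow> dg v1 (4 * F + 3 * G)" using L(1) FG by simp
  show "a1 = 0 \<Longrightarrow> a1' = 0 \<Longrightarrow> dg v1 (2 * F + G)" using L(3) FG det by auto
qed

lemma v3_degree: "a3 \<noteq> 0 \<Longrightarrow> dg v3 (4 * F + 3 * G)"
  "a3 = 0 \<Longrightarrow> a3' \<noteq> 0 \<Longrightarrow> dg v3 (3 * F + 2 * G)"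
  "a3 = 0 \<Longrightarrow> a3' = 0 \<Longrightarrow> dg v3 (2 * F + G)"
proof -
  note const = const[unfolded is_const_def]
  have "d b3 \<le> 0" using const by simp
  note L = dg_linear_combination[OF dg_u(3,2,1) this _ _ _ const(9,10,11), folded v3_def]
  show "a3 \<noteq> 0 \<Longrightarrow> dg v3 (4 * F + 3 * G)" using L(1) FG by simp
  show "a3 = 0 \<Longrightarrow> a3' \<noteq> 0 \<Longrightarrow> dg v3 (3 * F + 2 * G)" using L(2) FG by simp
  show "a3 = 0 \<Longrightarrow> a3' = 0 \<Longrightarrow> dg v3 (2 * F + G)" using L(3) FG det by auto
qed

text \<open>
  Here the leading terms of both \<open>g'\<close> and \<open>r'\<close> may cancel, so \<open>g'\<close> is recovered from
  \<open>v1 * g' = r'\<^sup>2 + f' ^ 3\<close>; the degree of \<open>r'\<close> is never \<open>3/2\<close> of that of \<open>f'\<close>.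
\<close>

lemma pre_state_if_f'_degree_eq:
  assumes a: "a1 \<noteq> 0" "a3 \<noteq> 0" and z: "c1 = 0" "c2 = 0" "c3 = 0" "c4 = 0" and c5: "c5 \<noteq> 0"
  shows "pre_state v1 v2 v3"
proof (rule pre_state_via_form_r)
  show f': "dg f' (4 * F + 3 * G)" using f'_degree(5) z c5 by simp
  show "dg v1 (4 * F + 3 * G)" using v1_degree(1) a by simp
  show "1 \<le> 4 * F + 3 * G" using FG by simp
  have a2: "a2 \<noteq> 0" using z(1) a unfolding c1_def by auto
  \<comment> \<open>\<open>w1\<close>, \<open>w2\<close>, \<open>t\<close> are the tails of
    \<open>v1\<close>, \<open>v2\<close>, \<open>f'\<close> of degree at most
    \<open>2 * F + G\<close>. In \<open>r' = v2 * f' + v1\<^sup>2\<close> the coefficients of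
    \<open>u3\<^sup>2\<close> and \<open>u3 * u2\<close> are \<open>k1\<close> and
    \<open>k3\<close>; \<open>e\<close> gathers terms of degree at most
    \<open>6 * F + 4 * G\<close>.\<close>
  define w1 where "w1 = a1'' * u1 + b1"
  define w2 where "w2 = a2'' * u1 + b2"
  define t where "t = c8 * u1 + c9 * f + c0"
  define k1 where "k1 = a2 * c5 + a1\<^sup>2"
  define k3 where "k3 = a2 * c7 + a2' * c5 + 2 * a1 * a1'"
  define e where "e = a1'\<^sup>2 * u2\<^sup>2 + 2 * (a1 * (u3 * w1)) + 2 * (a1' * (u2 * w1)) + w1\<^sup>2
    + (a2 * (u3 * t) + a2' * c7 * u2\<^sup>2 + a2' * (u2 * t) + w2 * f')"
  define e' where "e' = a2' * c6 * (u2 * u1\<^sup>2) + e"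
  have f'_eq': "f' = c5 * u3 + c6 * u1\<^sup>2 + c7 * u2 + t"
    unfolding f'_eq t_def using z by simp
  have "r' = (a2 * u3 + a2' * u2) * f' + (w2 * f' + v1\<^sup>2)"
    unfolding form_r_def v2_def w2_def by (simp add: algebra_simps)
  also have "(a2 * u3 + a2' * u2) * f' = a2 * c5 * u3\<^sup>2 + a2 * c6 * (u3 * u1\<^sup>2)
      + (a2 * c7 + a2' * c5) * (u3 * u2) + a2' * c6 * (u2 * u1\<^sup>2)
      + (a2 * (u3 * t) + a2' * c7 * u2\<^sup>2 + a2' * (u2 * t))"
    unfolding f'_eq' by (simp add: algebra_simps power2_eq_square)
  also have "v1\<^sup>2 = a1\<^sup>2 * u3\<^sup>2 + 2 * a1 * a1' * (u3 * u2)
      + (a1'\<^sup>2 * u2\<^sup>2 + 2 * (a1 * (u3 * w1)) + 2 * (a1' * (u2 * w1)) + w1\<^sup>2)"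
    unfolding v1_def w1_def by (simp add: algebra_simps power2_eq_square)
  finally have r': "r' = k1 * u3\<^sup>2 + a2 * c6 * (u3 * u1\<^sup>2) + k3 * (u3 * u2) + e'"
    unfolding e'_def e_def k1_def k3_def by (simp add: algebra_simps)
  note const = const c_const
  have k: "d k1 = 0" "d (a2 * c6) = 0" "d k3 = 0" "d (a2' * c6) = 0"
    unfolding k1_def k3_def is_const_def[symmetric] by (intro is_const_intros const)+
  note [simp] = dg_u[THEN dg_d] dg_fgr[THEN dg_d]
  have w: "d w1 \<le> 2 * F + G" "d w2 \<le> 2 * F + G" "d t \<le> 2 * F + G"
    unfolding w1_def w2_def t_def
    by (intro d_add_le d_cmult_le const[unfolded is_const_def];
      use const[unfolded is_const_def] FG in simp)+
  have m: "dg (u3\<^sup>2) (8 * F + 6 * G)" "dg (u3 * u1\<^sup>2) (8 * F + 5 * G)" "dg (u3 * u2) (7 * F + 5 * G)"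
    using dg_power[OF dg_u(3), of 2] dg_mult[OF dg_u(3) dg_power[OF dg_u(1), of 2]]
      dg_mult[OF dg_u(3,2)] by (simp_all add: dg_def)
  have ee: "d e \<le> 6 * F + 4 * G"
  proof -
    have c: "d (a1'\<^sup>2) = 0" "d a1 = 0" "d a1' = 0" "d a2 = 0" "d (a2' * c7) = 0" "d a2' = 0"
      unfolding is_const_def[symmetric] by (intro is_const_intros const)+
    have m: "d (u2\<^sup>2) \<le> 6 * F + 4 * G" "d (u3 * w1) \<le> 6 * F + 4 * G" "d (u2 * w1) \<le> 6 * F + 4 * G"
      "d (w1\<^sup>2) \<le> 6 * F + 4 * G" "d (u3 * t) \<le> 6 * F + 4 * G" "d (u2 * t) \<le> 6 * F + 4 * G"
      "d (w2 * f') \<le> 6 * F + 4 * G"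
      using d_power_le[of u2 2] d_mult_le[of u3 w1] d_mult_le[of u2 w1] d_power_le[of w1 2]
        d_mult_le[of u3 t] d_mult_le[of u2 t] d_mult_le[of w2 f'] dg_d[OF f'] w by simp_all
    show ?thesis unfolding e_def by (intro d_add_le m d_cmult_le c d_2)
  qed
  \<comment> \<open>The critical value \<open>(12 * F + 9 * G) / 2\<close> lies strictly above the
    bound for \<open>e\<close> and below the degrees of the three leading monomials. The term in
    \<open>u2 * u1\<^sup>2\<close> may lie on either side of it, but its coefficient is a multiple
    of \<open>c6\<close>, and if \<open>c6\<close> is nonzero then \<open>k1\<close> or
    \<open>a2 * c6\<close> yields a larger term.\<close>
  show "(\<exists>k. dg r' k \<and> 3 * (4 * F + 3 * G) < 2 * k) \<or> 2 * d r' < 3 * (4 * F + 3 * G)"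
  proof (cases "k1 = 0 \<and> c6 = 0")
    case False
    have "d (u2 * u1\<^sup>2) \<le> 7 * F + 4 * G"
      using d_mult_le[of u2 "u1\<^sup>2"] d_power_le[of u1 2] by simp
    then have "d e' \<le> 7 * F + 4 * G"
      unfolding e'_def by (intro d_add_le d_cmult_le[OF k(4)]) (use ee in auto)
    note L = dg_linear_combination[OF m this _ _ _ k(1-3), folded r']
    from False consider "k1 \<noteq> 0" | "k1 = 0" "a2 * c6 \<noteq> 0" using a2 by auto
    then show ?thesis
    proof cases
      case 1
      then have "dg r' (8 * F + 6 * G)" by (intro L(1)) (use FG in auto)
      then show ?thesis using FG by (intro disjI1 exI[of _ "8 * F + 6 * G"]) auto
    next
      case 2
      then have "dg r' (8 * F + 5 * G)" by (intro L(2)) (use FG in auto)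
      then show ?thesis using FG by (intro disjI1 exI[of _ "8 * F + 5 * G"]) auto
    qed
  next
    case True
    then have r'': "r' = k3 * (u3 * u2) + e" unfolding r' e'_def by simp
    show ?thesis
    proof (cases "k3 = 0")
      case False
      have "dg r' (7 * F + 5 * G)"
        unfolding r'' by (intro dg_add dg_cmult False k m) (use ee FG in simp)
      then show ?thesis using FG by (intro disjI1 exI[of _ "7 * F + 5 * G"]) auto
    next
      case True
      then show ?thesis using ee FG unfolding r'' by (intro disjI2) simp
    qed
  qed
qed

text \<open>Here \<open>f'\<close> is too small for the domination lemmas, so \<open>g'\<close> is
  expanded. Either \<open>u1 ^ 3\<close> leads, or its coefficient vanishes, which forces the
  diagonal into the torus; then a nonzero off-diagonal entry supplies the leading term
  \<open>f\<^sup>2 * u1\<close>.\<close>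

lemma pre_state_if_f'_multiple_of_f:
  assumes a: "a1 = 0" "a2 = 0" "a1' = 0"
    and z: "c3 = 0" "c4 = 0" "c5 = 0" "c6 = 0" "c7 = 0" "c8 = 0"
    and not_torus: "\<not> (a1'' = a3 ^ 3 \<and> a2' = a3\<^sup>2 \<and> a2'' = 0 \<and> a3' = 0 \<and> a3'' = 0 \<and>
      b1 = 0 \<and> b2 = 0 \<and> b3 = 0)"
  shows "pre_state v1 v2 v3"
proof -
  have nz: "a1'' \<noteq> 0" "a2' \<noteq> 0" "a3 \<noteq> 0" using det a by auto
  \<comment> \<open>Successively, \<open>c5\<close> reduces to \<open>a3 * b1\<close>,
    \<open>c7\<close> to \<open>- 2 * a2' * b2\<close> and \<open>c8\<close> to
    \<open>a1'' * b3\<close>.\<close>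
  have b1: "b1 = 0" using z(3) a nz unfolding c5_def by simp
  have b2: "b2 = 0" using z(5) a nz b1 two_neq_0 unfolding c7_def by simp
  have b3: "b3 = 0" using z(6) a nz b1 b2 unfolding c8_def by simp
  have s1: "a1'' * a3 = a2'\<^sup>2" using z(1) a unfolding c3_def by simp
  have s2: "a1'' * a3' = 2 * a2' * a2''" using z(2) a unfolding c4_def by simp
  have s3: "a1'' * a3'' = a2''\<^sup>2" using z(4) a unfolding c6_def by simp
  have v: "v1 = a1'' * u1" "v2 = a2' * u2 + a2'' * u1" "v3 = a3 * u3 + a3' * u2 + a3'' * u1"
    unfolding v1_def v2_def v3_def using a b1 b2 b3 by simp_all
  define k where "k = a1'' * a3"
  have kc: "is_const k" "k \<noteq> 0" unfolding k_def using nz is_const_mult[OF const(3,9)] by auto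
  have f': "f' = k * f"
    unfolding f'_eq z c0_def c1_def c2_def c9_def k_def using a b1 b2 b3 by simp
  then have df': "dg f' F" using kc dg_fgr by (simp add: dg_cmult is_const_def)
  \<comment> \<open>\<open>A\<close>, \<open>B\<close>, \<open>C\<close> are the coefficients of
    \<open>u3 * f\<^sup>2\<close>, \<open>2 * u1 * u2 * f\<close> and \<open>u1 ^ 3\<close> in
    \<open>g'\<close>; \<open>form_relations\<close> then replaces \<open>u3 * f\<^sup>2\<close> and
    \<open>u2 * f\<close> by expressions in g, r, \<open>u1\<close>.\<close>
  define A where "A = a3 * k\<^sup>2"
  define B where "B = a1'' * a2' * k"
  define C where "C = a1'' ^ 3"
  have abc: "is_const A" "is_const B" "is_const C"
    unfolding A_def B_def C_def by (intro is_const_intros const kc)+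
  have AC: "A * C = B\<^sup>2"
  proof -
    have "A * C = a1''\<^sup>2 * k\<^sup>2 * (a1'' * a3)"
      by (simp add: A_def C_def power2_eq_square power3_eq_cube algebra_simps)
    also have "\<dots> = B\<^sup>2"
      unfolding s1 by (simp add: B_def power2_eq_square algebra_simps)
    finally show ?thesis .
  qed
  have g'1: "g' = A * g + 2 * ((B - A) * (u1 * r)) + (A - 2 * B + C) * u1 ^ 3
    + (k\<^sup>2 * a3' * (f\<^sup>2 * u2) + k\<^sup>2 * a3'' * (f\<^sup>2 * u1) + 2 * (a1'' * a2'' * k * (u1\<^sup>2 * f)))"
  proof -
    have "g' = A * (u3 * f\<^sup>2) + 2 * (B * (u1 * (u2 * f))) + C * u1 ^ 3
    + (k\<^sup>2 * a3' * (f\<^sup>2 * u2) + k\<^sup>2 * a3'' * (f\<^sup>2 * u1) + 2 * (a1'' * a2'' * k * (u1\<^sup>2 * f)))"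
      unfolding form_g_def[of v1 v2 v3] f' unfolding v A_def B_def C_def
      by (simp add: power2_eq_square power3_eq_cube algebra_simps)
    then show ?thesis
      unfolding form_relations(2,3)
      by (simp add: power2_eq_square power3_eq_cube algebra_simps)
  qed
  note const = const abc kc(1)
  note [simp] = dg_u[THEN dg_d] dg_fgr[THEN dg_d]
  have m: "d (f\<^sup>2 * u2) \<le> 5 * F + 2 * G" "d (f\<^sup>2 * u1) \<le> 4 * F + G" "d (u1\<^sup>2 * f) \<le> 5 * F + 2 * G"
    "d (u1 * r) \<le> 3 * F + 2 * G" "d (u2 * f) \<le> 4 * F + 2 * G" "d (u1 * f) \<le> 3 * F + G"
    "d (u1\<^sup>2) \<le> 4 * F + 2 * G" "d (r * f) \<le> 2 * F + G"
    using d_mult_le[of "f\<^sup>2" u2] d_mult_le[of "f\<^sup>2" u1] d_mult_le[of "u1\<^sup>2" f]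
      d_mult_le[of u1 r] d_mult_le[of u2 f] d_mult_le[of u1 f] d_mult_le[of r f]
      d_power_le[of f 2] d_power_le[of u1 2] by simp_all
  show ?thesis
  proof (cases "A - 2 * B + C = 0")
    case False
    let ?e = "A * g + 2 * ((B - A) * (u1 * r)) + (k\<^sup>2 * a3' * (f\<^sup>2 * u2)
      + k\<^sup>2 * a3'' * (f\<^sup>2 * u1) + 2 * (a1'' * a2'' * k * (u1\<^sup>2 * f)))"
    have "is_const (A - 2 * B + C)" by (intro is_const_intros const)
    moreover have "dg (u1 ^ 3) (6 * F + 3 * G)" using dg_power[OF dg_u(1), of 3] by simp
    moreover have "d ?e < 6 * F + 3 * G"
    proof -
      have c: "d A = 0" "d (B - A) = 0" "d (k\<^sup>2 * a3') = 0" "d (k\<^sup>2 * a3'') = 0" "d (a1'' * a2'' * k) = 0"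
        unfolding is_const_def[symmetric] by (intro is_const_intros const)+
      have "d g < 6 * F + 3 * G" "d (u1 * r) < 6 * F + 3 * G" "d (f\<^sup>2 * u2) < 6 * F + 3 * G"
        "d (f\<^sup>2 * u1) < 6 * F + 3 * G" "d (u1\<^sup>2 * f) < 6 * F + 3 * G"
        using m FG by simp_all
      note m = this
      show ?thesis by (intro d_add_less d_2mult_less m d_cmult_less c)
    qed
    ultimately have "dg ((A - 2 * B + C) * u1 ^ 3 + ?e) (6 * F + 3 * G)"
      using False by (intro dg_add dg_cmult) (auto simp: is_const_def)
    then have "dg g' (6 * F + 3 * G)" unfolding g'1 by (simp add: algebra_simps)
    moreover have "d r' < F + (6 * F + 3 * G)"
    proof -
      have "r' = k * a2' * (u2 * f) + k * a2'' * (u1 * f) + a1''\<^sup>2 * u1\<^sup>2"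
        unfolding form_r_def f' unfolding v by (simp add: algebra_simps power2_eq_square)
      moreover have "d \<dots> < F + (6 * F + 3 * G)"
      proof -
        have c: "d (k * a2') = 0" "d (k * a2'') = 0" "d (a1''\<^sup>2) = 0"
          unfolding is_const_def[symmetric] by (intro is_const_intros const)+
        have "d (u2 * f) < F + (6 * F + 3 * G)" "d (u1 * f) < F + (6 * F + 3 * G)"
          "d (u1\<^sup>2) < F + (6 * F + 3 * G)"
          using m FG by simp_all
        note m = this
        show ?thesis by (intro d_add_less m d_cmult_less c)
      qed
      ultimately show ?thesis by simp
    qed
    ultimately show ?thesis
      unfolding pre_state_def using df' FG
      by (intro exI[of _ F] exI[of _ "6 * F + 3 * G"]) auto
  next
    case True
    \<comment> \<open>Since \<open>A * C = B\<^sup>2\<close>, the vanishing coefficient times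
      \<open>A\<close> is a perfect square, so \<open>A = B = C\<close>; this makes the diagonal
      \<open>a3 ^ 3\<close>, \<open>a3\<^sup>2\<close>, \<open>a3\<close>.\<close>
    have "(A - B)\<^sup>2 = A * (A - 2 * B + C)"
      using AC by (simp add: power2_eq_square algebra_simps)
    then have "A = B" using True by simp
    moreover from this have "C - B = A - 2 * B + C" by (simp add: algebra_simps)
    ultimately have AB: "A = B" "C = B" using True by simp_all
    have "a3 * k = a1'' * a2'" using AB(1) kc by (simp add: A_def B_def power2_eq_square)
    then have g2: "a2' = a3\<^sup>2" using nz by (simp add: k_def power2_eq_square)
    have "a1'' * (a1'' * a1'') = a1'' * (a1'' * (a2' * a3))"
      using AB(2) by (simp add: C_def B_def k_def power3_eq_cube algebra_simps)
    then have g3: "a1'' = a3 ^ 3" using nz g2 by (simp add: power2_eq_square power3_eq_cube)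
    have g4: "a3 * a3' = 2 * a2''"
      using s2 nz unfolding g2 g3 by (simp add: power2_eq_square power3_eq_cube)
    have a2'': "a2'' \<noteq> 0"
    proof
      assume "a2'' = 0"
      then have "a3' = 0" "a3'' = 0" using g4 s3 nz by auto
      then show False using not_torus g2 g3 b1 b2 b3 \<open>a2'' = 0\<close> by simp
    qed
    then have a3'': "a3'' \<noteq> 0" using s3 by auto
    have k: "k = a3 ^ 4" unfolding k_def g3 by (simp add: eval_nat_numeral)
    \<comment> \<open>The terms in \<open>f\<^sup>2 * u2\<close> and \<open>u1\<^sup>2 * f\<close>
      turn out to have the same coefficient and combine to a multiple of \<open>r * f\<close>, of
      degree only \<open>2 * F + G\<close>. This leaves \<open>f\<^sup>2 * u1\<close> in
      front.\<close>
    have "g' = A * g + (k\<^sup>2 * a3' * (f\<^sup>2 * u2) + k\<^sup>2 * a3'' * (f\<^sup>2 * u1)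
        + 2 * (a1'' * a2'' * k * (u1\<^sup>2 * f)))"
      unfolding g'1 AB by (simp add: algebra_simps)
    also have "k\<^sup>2 * a3' = a3 ^ 7 * (a3 * a3')" unfolding k by (simp add: eval_nat_numeral algebra_simps)
    also have "\<dots> = 2 * a3 ^ 7 * a2''" unfolding g4 by simp
    also have "2 * (a1'' * a2'' * k * (u1\<^sup>2 * f)) = 2 * a3 ^ 7 * a2'' * (u1\<^sup>2 * f)"
      unfolding g3 k by (simp add: eval_nat_numeral algebra_simps)
    finally have g'2: "g' = k\<^sup>2 * a3'' * (f\<^sup>2 * u1) + (A * g + 2 * (a3 ^ 7 * a2'' * (r * f)))"
      unfolding form_r_def by (simp add: power2_eq_square algebra_simps)
    have "dg g' (4 * F + G)"
      unfolding g'2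
    proof (rule dg_add)
      have c: "d (k\<^sup>2 * a3'') = 0" "d A = 0" "d (a3 ^ 7 * a2'') = 0"
        unfolding is_const_def[symmetric] by (intro is_const_intros const)+
      have "dg (f\<^sup>2 * u1) (4 * F + G)"
        using dg_mult[OF dg_power[OF dg_fgr(1), of 2] dg_u(1)] by simp
      then show "dg (k\<^sup>2 * a3'' * (f\<^sup>2 * u1)) (4 * F + G)"
        using dg_cmult[OF _ c(1)] kc a3'' by simp
      have "d g < 4 * F + G" "d (r * f) < 4 * F + G" using m FG by simp_all
      note m = this
      show "d (A * g + 2 * (a3 ^ 7 * a2'' * (r * f))) < 4 * F + G"
        by (intro d_add_less d_2mult_less m d_cmult_less c)
    qed
    moreover have "d r' < F + (4 * F + G)"
    proof -
      have "r' = a3 ^ 6 * r + k * a2'' * (u1 * f)"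
        unfolding form_r_def[of v1 v2 v3] f' unfolding v unfolding g2 g3 k
        unfolding form_r_def by (simp add: eval_nat_numeral algebra_simps)
      moreover have "d \<dots> < F + (4 * F + G)"
      proof -
        have c: "d (a3 ^ 6) = 0" "d (k * a2'') = 0"
          unfolding is_const_def[symmetric] by (intro is_const_intros const)+
        have "d r < F + (4 * F + G)" "d (u1 * f) < F + (4 * F + G)" using m FG by simp_all
        note m = this
        show ?thesis by (intro d_add_less m d_cmult_less c)
      qed
      ultimately show ?thesis by simp
    qed
    ultimately show ?thesis
      unfolding pre_state_def using df' FG
      by (intro exI[of _ F] exI[of _ "4 * F + G"]) auto
  qed
qed

text \<open>The coefficients decide whether \<open>v3 * f'\<^sup>2\<close> or \<open>v1 ^ 3\<close>
  leads in \<open>g'\<close>. Two borderline cases have their own lemmas: \<open>f'\<close>,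
  \<open>v1\<close>, \<open>v3\<close> of equal degree, and \<open>f'\<close> of degree
  \<open>F\<close>.\<close>

lemma pre_state_affine_image:
  assumes not_torus: "\<not> (a1 = 0 \<and> a1' = 0 \<and> a2 = 0 \<and>
      a1'' = a3 ^ 3 \<and> a2' = a3\<^sup>2 \<and> a2'' = 0 \<and> a3' = 0 \<and> a3'' = 0 \<and>
      b1 = 0 \<and> b2 = 0 \<and> b3 = 0)"
  shows "pre_state v1 v2 v3"
proof (cases "c1 = 0")
  case False
  \<comment> \<open>\<open>v1\<close> and \<open>v2\<close> may both reach
    \<open>4 * F + 3 * G\<close>, together exactly the degree of \<open>f'\<close>, so the strict
    bound requires \<open>v3\<close> to be nonconstant.\<close>
  obtain D3 where D3: "dg v3 D3" "1 \<le> D3"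
  proof -
    have "\<exists>n. dg v3 n \<and> 1 \<le> n"
      using v3_degree FG by (cases "a3 = 0"; cases "a3' = 0") (force simp: dg_def)+
    then show thesis using that by blast
  qed
  show ?thesis
    by (rule pre_state_if_f_dominates[OF f'_degree(1)[OF False] _ v_degree_le(1,2) D3(1)])
      (use FG D3 in auto)
next
  case c1: True
  show ?thesis
  proof (cases "a1 = 0")
    case a1: True
    then have a2: "a2 = 0" using c1 unfolding c1_def by simp
    have a3: "a3 \<noteq> 0" using det a1 a2 by auto
    show ?thesis
    proof (cases "a1' = 0")
      case False
      then have "c2 \<noteq> 0" unfolding c2_def using a1 a2 a3 by simp
      show ?thesis
        by (rule pre_state_if_f_dominates[OF f'_degree(2)[OF c1 \<open>c2 \<noteq> 0\<close>] _
            v_degree_le2(1)[OF a1] v_degree_le2(2)[OF a2] v3_degree(1)[OF a3]]) (use FG in auto)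
    next
      case a1': True
      have c2: "c2 = 0" unfolding c2_def using a1 a2 a1' by simp
      have v1: "d v1 \<le> 2 * F + G" using v1_degree(2)[OF a1 a1'] by (simp add: dg_def)
      \<comment> \<open>With these degrees the two bounds are
        \<open>5 * F + 3 * G < 4 * F + 3 * G + n\<close> and
        \<open>6 * F + 3 * G < 4 * F + 3 * G + 2 * n\<close>; both say \<open>F < n\<close>.\<close>
      have *: ?thesis if "dg f' n" "F < n" for n
        by (rule pre_state_if_f_dominates[OF that(1) _ v1 v_degree_le2(2)[OF a2] v3_degree(1)[OF a3]])
          (use FG that in auto)
      show ?thesis
      proof (cases "c3 = 0 \<and> c4 = 0 \<and> c5 = 0")
        case False
        then consider "c3 \<noteq> 0" | "c3 = 0" "c4 \<noteq> 0" | "c3 = 0" "c4 = 0" "c5 \<noteq> 0" by blast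
        then show ?thesis
        proof cases
          case 1 then show ?thesis using *[OF f'_degree(3)[OF c1 c2]] FG by simp
        next
          case 2 then show ?thesis using *[OF f'_degree(4)[OF c1 c2]] FG by simp
        next
          case 3 then show ?thesis using *[OF f'_degree(5)[OF c1 c2]] FG by simp
        qed
      next
        case True
        with f'_degree(6)[OF c1 c2] obtain n where
          n: "dg f' n" "F \<le> n" "c6 = 0 \<and> c7 = 0 \<and> c8 = 0 \<or> F < n" by blast
        show ?thesis
        proof (cases "F < n")
          case False
          then show ?thesis
            using n True not_torus a1 a2 a1'
            by (intro pre_state_if_f'_multiple_of_f) auto
        qed (use * n in blast)
      qed
    qed
  next
    case a1: False
    note v1 = v1_degree(1)[OF a1]
    show ?thesis
    proof (cases "a3 = 0")
      case a3: False
      \<comment> \<open>\<open>v1\<close> and \<open>v3\<close> have degree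
        \<open>4 * F + 3 * G\<close>, so a larger \<open>f'\<close> makes
        \<open>v3 * f'\<^sup>2\<close> lead and a smaller one \<open>v1 ^ 3\<close>.\<close>
      have hi: ?thesis if "dg f' n" "4 * F + 3 * G < n" for n
        by (rule pre_state_if_f_dominates[OF that(1) _ v_degree_le(1,2) v3_degree(1)[OF a3]])
          (use FG that in auto)
      have lo: ?thesis if "dg f' n" "n < 4 * F + 3 * G" "F \<le> n" for n
        by (rule pre_state_if_v1_dominates[OF that(1) _ v1 v_degree_le(2,3)])
          (use FG that in auto)
      consider "c2 \<noteq> 0" | "c2 = 0" "c3 \<noteq> 0" | "c2 = 0" "c3 = 0" "c4 \<noteq> 0"
        | "c2 = 0" "c3 = 0" "c4 = 0" "c5 \<noteq> 0" | "c2 = 0" "c3 = 0" "c4 = 0" "c5 = 0" by blast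
      then show ?thesis
      proof cases
        case 1 then show ?thesis using hi[OF f'_degree(2)[OF c1]] FG by simp
      next
        case 2 then show ?thesis using hi[OF f'_degree(3)[OF c1]] FG by simp
      next
        case 3 then show ?thesis using hi[OF f'_degree(4)[OF c1]] FG by simp
      next
        case 4 then show ?thesis using pre_state_if_f'_degree_eq a1 a3 c1 by simp
      next
        case 5 then show ?thesis using f'_degree(6)[OF c1] lo by blast
      qed
    next
      case a3: True
      then have a2: "a2 = 0" using c1 unfolding c1_def by simp
      show ?thesis
      proof (cases "a3' = 0")
        case False
        then have "c2 \<noteq> 0" unfolding c2_def using a1 a2 a3 by simp
        show ?thesis
          by (rule pre_state_if_f_dominates[OF f'_degree(2)[OF c1 \<open>c2 \<noteq> 0\<close>] _
              v_degree_le(1) v_degree_le2(2)[OF a2] v3_degree(2)[OF a3 False]]) (use FG in auto)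
      next
        case a3': True
        have c2: "c2 = 0" unfolding c2_def using a2 a3 a3' by simp
        note v3 = v3_degree(3)[OF a3 a3']
        show ?thesis
        proof (cases "c3 = 0")
          case False
          show ?thesis
            by (rule pre_state_if_f_dominates[OF f'_degree(3)[OF c1 c2 False] _
              v_degree_le(1) v_degree_le2(2)[OF a2] v3]) (use FG in auto)
        next
          case c3: True
          \<comment> \<open>As \<open>v3\<close> has degree \<open>2 * F + G\<close>, this bound on
            \<open>n\<close> keeps \<open>v3 * f'\<^sup>2\<close> within
            \<open>12 * F + 7 * G\<close>, below \<open>3 * (4 * F + 3 * G)\<close>.\<close>
          obtain n where n: "dg f' n" "1 \<le> n" "n \<le> 5 * F + 3 * G"
          proof -
            consider "c4 \<noteq> 0" | "c4 = 0" "c5 \<noteq> 0" | "c4 = 0" "c5 = 0" by blast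
            then show thesis
            proof cases
              case 1 then show ?thesis using that[OF f'_degree(4)[OF c1 c2 c3]] FG by simp
            next
              case 2 then show ?thesis using that[OF f'_degree(5)[OF c1 c2 c3]] FG by simp
            next
              case 3
              from f'_degree(6)[OF c1 c2 c3 this] obtain n where
                "dg f' n" "F \<le> n" "n < 4 * F + 3 * G" by blast
              then show ?thesis using that[of n] FG by simp
            qed
          qed
          show ?thesis
            by (rule pre_state_if_v1_dominates[OF n(1,2) v1 v_degree_le2(2)[OF a2]
              eq_refl[OF dg_d[OF v3]]]) (use FG n in auto)
        qed
      qed
    qed
  qed
qed

end

subsection \<open>The total degree\<close>

definition mdeg :: "(3 \<Rightarrow>\<^sub>0 nat) \<Rightarrow> nat" where
  "mdeg m = (\<Sum>i\<in>UNIV. Poly_Mapping.lookup m i)"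

text \<open>The ring homomorphism \<open>x\<^sub>i \<mapsto> x\<^sub>i * t\<close>, whose degree in \<open>t\<close> is the total degree.\<close>

definition grade :: "'k::comm_ring_1 pol3 \<Rightarrow> 'k pol3 poly" where
  "grade p = (\<Sum>m\<in>Poly_Mapping.keys p.
     monom (Poly_Mapping.single m (Poly_Mapping.lookup p m)) (mdeg m))"

lemma mdeg_add: "mdeg (m + n) = mdeg m + mdeg n"
  by (simp add: mdeg_def lookup_add sum.distrib)

lemma grade_superset:
  assumes "finite S" "Poly_Mapping.keys p \<subseteq> S"
  shows "grade p = (\<Sum>m\<in>S. monom (Poly_Mapping.single m (Poly_Mapping.lookup p m)) (mdeg m))"
  unfolding grade_def using assms
  by (intro sum.mono_neutral_left) (auto simp: in_keys_iff)

lemma grade_add: "grade (p + q) = grade p + grade q"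
proof -
  let ?S = "Poly_Mapping.keys p \<union> Poly_Mapping.keys q"
  have "Poly_Mapping.keys (p + q) \<subseteq> ?S" by (rule Poly_Mapping.keys_add)
  then show ?thesis
    by (simp add: grade_superset[of ?S] sum.distrib lookup_add single_add flip: add_monom)
qed

lemma grade_single: "grade (Poly_Mapping.single m c) = monom (Poly_Mapping.single m c) (mdeg m)"
  by (subst grade_superset[of "{m}"]) auto

lemma grade_mult: "grade (p * q) = grade p * grade q"
proof (induction p rule: pol_induct_single)
  fix m c
  show "grade (Poly_Mapping.single m c * q) = grade (Poly_Mapping.single m c) * grade q"
    by (induction q rule: pol_induct_single)
       (simp_all add: grade_add grade_single mult_single mult_monom mdeg_add algebra_simps)
qed (simp add: grade_add algebra_simps)

text \<open>Setting t to 1 undoes \<open>grade\<close>, which is therefore injective; this lets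
  \<open>tdeg\<close> inherit additivity on products from univariate polynomials over a
  domain.\<close>

lemma poly_grade: "poly (grade p) 1 = p"
  by (induction p rule: pol_induct_single) (simp_all add: grade_add grade_single poly_monom)

lemma grade_pconst: "grade (pconst c) = [:pconst c:]"
  by (simp add: pconst_def grade_single mdeg_def monom_0)

lemma grade_pvar: "grade (pvar i) = monom (pvar i) 1"
proof -
  have "mdeg (Poly_Mapping.single i 1) = 1" by (simp add: mdeg_def lookup_single when_def)
  then show ?thesis by (simp add: pvar_def grade_single)
qed

lemma grade_diff: "grade (p - q) = grade p - grade q"
  using grade_add[of "p - q" q] by (simp add: algebra_simps)

lemma grade_0: "grade 0 = 0"
  using grade_pconst[of 0] by simp

definition tdeg :: "'k::comm_ring_1 pol3 \<Rightarrow> nat" where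
  "tdeg p = Polynomial.degree (grade p)"

interpretation tdeg: degree_map "tdeg :: 'k::field_char_0 pol3 \<Rightarrow> nat"
proof
  fix x y :: "'k pol3"
  show "tdeg (0 :: 'k pol3) = 0" by (simp add: tdeg_def grade_0)
  show "tdeg (x + y) \<le> max (tdeg x) (tdeg y)"
    unfolding tdeg_def grade_add by (rule degree_add_le_max)
  assume "x \<noteq> 0" "y \<noteq> 0"
  then have "grade x \<noteq> 0" "grade y \<noteq> 0" using poly_grade by (metis poly_0)+
  then show "tdeg (x * y) = tdeg x + tdeg y"
    unfolding tdeg_def grade_mult by (rule degree_mult_eq)
qed simp

lemma tdeg_pconst: "tdeg (pconst c) = 0"
  by (simp add: tdeg_def grade_pconst)

lemma pvar_neq_0: "(pvar i :: 'k::field pol3) \<noteq> 0"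
proof
  assume "(pvar i :: 'k pol3) = 0"
  then have "pdiff i (pvar i) = (0 :: 'k pol3)"
    using pdiff_pconst[of i "0 :: 'k"] by simp
  then have "(1 :: 'k pol3) = 0" by (simp add: pdiff_pvar)
  then show False by simp
qed

lemma tdeg_pvar: "tdeg (pvar i :: 'k::field_char_0 pol3) = 1"
  by (simp add: tdeg_def grade_pvar degree_monom_eq pvar_neq_0)

subsection \<open>Homomorphisms and affine automorphisms\<close>

lemma pol_hom_eqI:
  assumes "pol_algebra_hom \<phi>" "pol_algebra_hom \<psi>" "\<And>i. \<phi> (pvar i) = \<psi> (pvar i)"
  shows "\<phi> = \<psi>"
proof
  fix p show "\<phi> p = \<psi> p"
    by (induction p rule: pol_induct) (use assms in \<open>simp_all add: pol_algebra_hom_def\<close>)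
qed

lemma Aut3_simps: "carrier Aut3 = {\<phi>. pol_algebra_hom \<phi> \<and> bij \<phi>}"
  "\<phi> \<otimes>\<^bsub>Aut3\<^esub> \<psi> = \<phi> \<circ> \<psi>" "\<one>\<^bsub>Aut3\<^esub> = id"
  by (simp_all add: Aut3_def)

context
  fixes \<phi> :: "'k::field pol3 \<Rightarrow> 'k pol3"
  assumes hom: "pol_algebra_hom \<phi>"
begin

lemma hom_add: "\<phi> (p + q) = \<phi> p + \<phi> q"
  and hom_mult: "\<phi> (p * q) = \<phi> p * \<phi> q"
  and hom_pconst: "\<phi> (pconst c) = pconst c"
  using hom by (simp_all add: pol_algebra_hom_def)

lemma hom_0: "\<phi> 0 = 0" and hom_1: "\<phi> 1 = 1"
  using hom_pconst[of 0] hom_pconst[of 1] by simp_all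

lemma hom_diff: "\<phi> (p - q) = \<phi> p - \<phi> q"
  using hom_add[of "p - q" q] by (simp add: algebra_simps)

lemma hom_numeral: "\<phi> (numeral n) = numeral n"
  using hom_pconst[of "numeral n"] by (simp add: pconst_def)

lemma hom_power: "\<phi> (p ^ n) = \<phi> p ^ n"
  by (induction n) (simp_all add: hom_1 hom_mult)

lemma hom_sum: "\<phi> (sum h A) = (\<Sum>x\<in>A. \<phi> (h x))"
  by (induction A rule: infinite_finite_induct) (simp_all add: hom_0 hom_add)

lemma hom_form_f: "\<phi> (form_f x y z) = form_f (\<phi> x) (\<phi> y) (\<phi> z)"
  and hom_form_g: "\<phi> (form_g x y z) = form_g (\<phi> x) (\<phi> y) (\<phi> z)"
  and hom_form_r: "\<phi> (form_r x y z) = form_r (\<phi> x) (\<phi> y) (\<phi> z)"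
  by (simp_all add: form_f_def form_g_def form_r_def hom_add hom_diff hom_mult hom_power hom_numeral)

end

lemmas hom_simps = hom_add hom_mult hom_pconst hom_diff hom_numeral hom_power hom_form_f hom_form_g hom_form_r

lemma pol_hom_comp: "pol_algebra_hom \<phi> \<Longrightarrow> pol_algebra_hom \<psi> \<Longrightarrow> pol_algebra_hom (\<phi> \<circ> \<psi>)"
  by (simp add: pol_algebra_hom_def)

lemma Aff3_iff: "\<alpha> \<in> Aff3 \<longleftrightarrow> \<alpha> \<in> carrier Aut3 \<and> (\<exists>A b. invertible A \<and>
     (\<forall>j. \<alpha> (pvar j) = (\<Sum>i\<in>UNIV. pvar i * pconst (A $ i $ j)) + pconst (b $ j)))"
  by (simp add: Aff3_def)

lemma pconst_sum: "pconst (sum h A) = (\<Sum>x\<in>A. pconst (h x))"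
  by (induction A rule: infinite_finite_induct) (simp_all add: pconst_add)

lemma Aff3_carrier: "\<alpha> \<in> Aff3 \<Longrightarrow> \<alpha> \<in> carrier Aut3"
  by (simp add: Aff3_def)

lemma Aff3_hom: "\<alpha> \<in> Aff3 \<Longrightarrow> pol_algebra_hom \<alpha>"
  by (simp add: Aff3_def Aut3_simps)

lemma sum_mult_pconst_mat_1:
  "(\<Sum>i\<in>UNIV. h i * pconst ((mat 1 :: 'k::field^3^3) $ i $ k)) = h k"
proof -
  have "h i * pconst ((mat 1 :: 'k^3^3) $ i $ k) = (if i = k then h i else 0)" for i
    by (simp add: mat_def)
  then show ?thesis by simp
qed

lemma Aff3_id: "id \<in> (Aff3 :: ('k::field pol3 \<Rightarrow> 'k pol3) set)"
proof -
  have "pvar j = (\<Sum>i\<in>UNIV. pvar i * pconst ((mat 1 :: 'k^3^3) $ i $ j)) + pconst ((0 :: 'k^3) $ j)"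
    for j
    by (simp add: sum_mult_pconst_mat_1)
  moreover have "invertible (mat 1 :: 'k^3^3)" by (simp add: invertible_det_nz)
  moreover have "id \<in> carrier (Aut3 :: ('k pol3 \<Rightarrow> 'k pol3) monoid)"
    by (simp add: Aut3_simps pol_algebra_hom_def)
  ultimately show ?thesis unfolding Aff3_iff id_apply by blast
qed

lemma Aff3_comp:
  assumes "\<alpha> \<in> Aff3" "\<beta> \<in> Aff3"
  shows "\<alpha> \<circ> \<beta> \<in> (Aff3 :: ('k::field pol3 \<Rightarrow> 'k pol3) set)"
proof -
  obtain A b B c where A: "invertible A" "\<And>j. \<alpha> (pvar j) = (\<Sum>i\<in>UNIV. pvar i * pconst (A $ i $ j)) + pconst (b $ j)"
    and B: "invertible B" "\<And>j. \<beta> (pvar j) = (\<Sum>i\<in>UNIV. pvar i * pconst (B $ i $ j)) + pconst (c $ j)"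
    using assms unfolding Aff3_iff by blast
  note hom = Aff3_hom[OF assms(1)]
  have "(\<alpha> \<circ> \<beta>) (pvar k) = (\<Sum>i\<in>UNIV. pvar i * pconst ((A ** B) $ i $ k))
      + pconst ((\<chi> k. (\<Sum>j\<in>UNIV. b $ j * B $ j $ k) + c $ k) $ k)" for k
  proof -
    have "(\<alpha> \<circ> \<beta>) (pvar k) = (\<Sum>j\<in>UNIV. ((\<Sum>i\<in>UNIV. pvar i * pconst (A $ i $ j)) + pconst (b $ j))
        * pconst (B $ j $ k)) + pconst (c $ k)"
      by (simp add: B(2) hom_add[OF hom] hom_sum[OF hom] hom_mult[OF hom] hom_pconst[OF hom] A(2))
    also have "\<dots> = (\<Sum>j\<in>UNIV. \<Sum>i\<in>UNIV. pvar i * pconst (A $ i $ j) * pconst (B $ j $ k))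
        + ((\<Sum>j\<in>UNIV. pconst (b $ j) * pconst (B $ j $ k)) + pconst (c $ k))"
      by (simp add: distrib_right sum.distrib sum_distrib_right add.assoc)
    also have "(\<Sum>j\<in>UNIV. \<Sum>i\<in>UNIV. pvar i * pconst (A $ i $ j) * pconst (B $ j $ k))
        = (\<Sum>i\<in>UNIV. pvar i * pconst ((A ** B) $ i $ k))"
      by (subst sum.swap) (simp add: matrix_matrix_mult_def pconst_sum pconst_mult sum_distrib_left mult.assoc)
    finally show ?thesis by (simp add: pconst_add pconst_sum pconst_mult)
  qed
  moreover have "\<alpha> \<circ> \<beta> \<in> carrier Aut3"
    using assms[THEN Aff3_carrier] by (auto simp: Aut3_simps pol_hom_comp bij_comp)
  ultimately show ?thesis
    unfolding Aff3_iff using invertible_mult[OF A(1) B(1)] by blast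
qed

lemma Aut3_inv:
  assumes "\<phi> \<in> carrier Aut3" "\<psi> \<circ> \<phi> = id" "\<psi> \<in> carrier Aut3"
  shows "inv\<^bsub>Aut3\<^esub> \<phi> = \<psi>"
  using group.inv_equality[OF group_Aut3, of \<psi> \<phi>] assms by (simp add: Aut3_simps(2,3))

text \<open>The inverse in \<open>Aut3\<close> is applied to the equations for
  \<open>\<alpha>\<close>; the inverse matrix \<open>B\<close> solves them for its values, which are
  affine.\<close>

lemma Aff3_inv:
  assumes "\<alpha> \<in> (Aff3 :: ('k::field pol3 \<Rightarrow> 'k pol3) set)"
  shows "\<exists>\<beta>\<in>Aff3. \<beta> \<circ> \<alpha> = id \<and> \<alpha> \<circ> \<beta> = id"
proof -
  obtain A b where A: "invertible A" "\<And>j. \<alpha> (pvar j) = (\<Sum>i\<in>UNIV. pvar i * pconst (A $ i $ j)) + pconst (b $ j)"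
    and car: "\<alpha> \<in> carrier Aut3" using assms unfolding Aff3_iff by blast
  define \<beta> where "\<beta> = inv\<^bsub>Aut3\<^esub> \<alpha>"
  have \<beta>: "\<beta> \<in> carrier Aut3" "\<beta> \<circ> \<alpha> = id" "\<alpha> \<circ> \<beta> = id"
    using group.inv_closed[OF group_Aut3 car] group.l_inv[OF group_Aut3 car]
      group.r_inv[OF group_Aut3 car] by (simp_all add: \<beta>_def Aut3_simps(2,3))
  then have hom: "pol_algebra_hom \<beta>" by (simp add: Aut3_simps)
  obtain B where B: "A ** B = mat 1" "B ** A = mat 1" using A(1) unfolding invertible_def by blast
  have eq: "pvar j = (\<Sum>i\<in>UNIV. \<beta> (pvar i) * pconst (A $ i $ j)) + pconst (b $ j)" for j
  proof -
    have "pvar j = \<beta> (\<alpha> (pvar j))" using \<beta>(2) by (simp add: fun_eq_iff)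
    also have "\<dots> = (\<Sum>i\<in>UNIV. \<beta> (pvar i) * pconst (A $ i $ j)) + pconst (b $ j)"
      by (simp add: A(2) hom_add[OF hom] hom_sum[OF hom] hom_mult[OF hom] hom_pconst[OF hom])
    finally show ?thesis .
  qed
  have "\<beta> (pvar k) = (\<Sum>j\<in>UNIV. pvar j * pconst (B $ j $ k))
      + pconst ((\<chi> k. - (\<Sum>j\<in>UNIV. b $ j * B $ j $ k)) $ k)" for k
  proof -
    have "(\<Sum>j\<in>UNIV. pvar j * pconst (B $ j $ k))
        = (\<Sum>j\<in>UNIV. ((\<Sum>i\<in>UNIV. \<beta> (pvar i) * pconst (A $ i $ j)) + pconst (b $ j)) * pconst (B $ j $ k))"
      by (rule sum.cong[OF refl]) (subst eq, rule refl)
    also have "\<dots> = (\<Sum>j\<in>UNIV. \<Sum>i\<in>UNIV. \<beta> (pvar i) * pconst (A $ i $ j) * pconst (B $ j $ k))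
        + (\<Sum>j\<in>UNIV. pconst (b $ j) * pconst (B $ j $ k))"
      by (simp add: distrib_right sum.distrib sum_distrib_right add.assoc)
    also have "(\<Sum>j\<in>UNIV. \<Sum>i\<in>UNIV. \<beta> (pvar i) * pconst (A $ i $ j) * pconst (B $ j $ k))
        = (\<Sum>i\<in>UNIV. \<beta> (pvar i) * pconst ((A ** B) $ i $ k))"
      by (subst sum.swap) (simp add: matrix_matrix_mult_def pconst_sum pconst_mult sum_distrib_left mult.assoc)
    also have "\<dots> = \<beta> (pvar k)"
      unfolding B by (rule sum_mult_pconst_mat_1)
    finally have "\<beta> (pvar k) = (\<Sum>j\<in>UNIV. pvar j * pconst (B $ j $ k))
        - (\<Sum>j\<in>UNIV. pconst (b $ j) * pconst (B $ j $ k))"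
      by (simp only: add_diff_cancel_right')
    then show ?thesis by (simp add: pconst_uminus pconst_sum pconst_mult)
  qed
  moreover have "invertible B" unfolding invertible_def using B by blast
  ultimately have "\<beta> \<in> Aff3" unfolding Aff3_iff using \<beta>(1) by blast
  then show ?thesis using \<beta> by blast
qed

abbreviation fpol :: "'k::field_char_0 pol3" where "fpol \<equiv> form_f (pvar 1) (pvar 2) (pvar 3)"
abbreviation gpol :: "'k::field_char_0 pol3" where "gpol \<equiv> form_g (pvar 1) (pvar 2) (pvar 3)"
abbreviation rpol :: "'k::field_char_0 pol3" where "rpol \<equiv> form_r (pvar 1) (pvar 2) (pvar 3)"

lemma dg_fpol: "tdeg.dg (fpol :: 'k::field_char_0 pol3) 2"
proof -
  have "grade fpol = monom (fpol :: 'k pol3) 2"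
    by (simp add: form_f_def grade_diff grade_mult grade_pvar power2_eq_square mult_monom
        diff_monom numeral_2_eq_2)
  moreover have "(fpol :: 'k pol3) \<noteq> 0"
  proof
    assume "(fpol :: 'k pol3) = 0"
    then have "pdiff 3 fpol = (0 :: 'k pol3)" using pdiff_pconst[of 3 "0 :: 'k"] by simp
    then have "pvar 1 = (0 :: 'k pol3)"
      by (simp add: form_f_def pdiff_simps power2_eq_square)
    then show False by (simp add: pvar_neq_0)
  qed
  ultimately show ?thesis by (simp add: tdeg.dg_def tdeg_def degree_monom_eq)
qed

text \<open>Base case for words: the variables have degree 1 and f has degree 2, which gives
  \<open>F = 2\<close> and \<open>G = 5\<close>.\<close>

lemma pre_state_id: "tdeg.pre_state (pvar 1) (pvar 2) (pvar 3 :: 'k::field_char_0 pol3)"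
  by (rule tdeg.pre_state_if_f_dominates[OF dg_fpol _ eq_refl[OF tdeg_pvar] eq_refl[OF tdeg_pvar], of 1])
     (simp_all add: tdeg.dg_def tdeg_pvar pvar_neq_0)

lemma fgr_of_hom:
  assumes "pol_algebra_hom \<psi>"
  shows "form_f (\<psi> (pvar 1)) (\<psi> (pvar 2)) (\<psi> (pvar 3)) = \<psi> fpol"
    "form_g (\<psi> (pvar 1)) (\<psi> (pvar 2)) (\<psi> (pvar 3)) = \<psi> gpol"
    "form_r (\<psi> (pvar 1)) (\<psi> (pvar 2)) (\<psi> (pvar 3)) = \<psi> rpol"
  by (simp_all add: hom_simps[OF assms])

text \<open>By \<open>form_relations\<close> the images of f, g, r determine those of the variables,
  since nonzero factors cancel in a domain.\<close>

lemma pol_hom_eqI_fgr: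
  fixes \<phi> \<psi> :: "'k::field_char_0 pol3 \<Rightarrow> 'k pol3"
  assumes hom: "pol_algebra_hom \<phi>" "pol_algebra_hom \<psi>"
    and eq: "\<phi> fpol = \<psi> fpol" "\<phi> gpol = \<psi> gpol" "\<phi> rpol = \<psi> rpol"
    and nz: "\<psi> fpol \<noteq> 0" "\<psi> gpol \<noteq> 0"
  shows "\<phi> = \<psi>"
proof (rule pol_hom_eqI[OF hom])
  have rel: "\<eta> (pvar 1) * \<eta> gpol = (\<eta> rpol)\<^sup>2 + \<eta> fpol ^ 3"
    "\<eta> (pvar 2) * \<eta> fpol = \<eta> rpol - (\<eta> (pvar 1))\<^sup>2"
    "\<eta> (pvar 3) * (\<eta> fpol)\<^sup>2 = \<eta> gpol - 2 * \<eta> (pvar 1) * \<eta> rpol + \<eta> (pvar 1) ^ 3"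
    if "pol_algebra_hom \<eta>" for \<eta> :: "'k pol3 \<Rightarrow> 'k pol3"
    unfolding fgr_of_hom[OF that, symmetric] by (rule form_relations)+
  note rel = rel[OF hom(1)] rel[OF hom(2)]
  have "\<phi> (pvar 1) * \<psi> gpol = \<psi> (pvar 1) * \<psi> gpol" using rel(1,4) eq by simp
  then have x: "\<phi> (pvar 1) = \<psi> (pvar 1)" using nz by simp
  have "\<phi> (pvar 2) * \<psi> fpol = \<psi> (pvar 2) * \<psi> fpol" using rel(2,5) eq x by simp
  then have y: "\<phi> (pvar 2) = \<psi> (pvar 2)" using nz by simp
  have "\<phi> (pvar 3) * (\<psi> fpol)\<^sup>2 = \<psi> (pvar 3) * (\<psi> fpol)\<^sup>2" using rel(3,6) eq x by simp
  then have z: "\<phi> (pvar 3) = \<psi> (pvar 3)" using nz by simp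
  show "\<phi> (pvar i) = \<psi> (pvar i)" for i using x y z exhaust_3[of i] by metis
qed

subsection \<open>The exponential flow of the derivation\<close>

definition flow :: "'k::field_char_0 \<Rightarrow> 'k pol3 \<Rightarrow> 'k pol3" where
  "flow c = exp_derivation (\<lambda>h. pconst c * jacobian_derivation fpol gpol h)"

lemma scaled_Delta:
  fixes c :: "'k::field_char_0"
  shows "pol_derivation (\<lambda>h. pconst c * jacobian_derivation fpol gpol h)"
    and "locally_nilpotent (\<lambda>h. pconst c * jacobian_derivation fpol gpol h)"
proof -
  let ?J = "jacobian_derivation fpol gpol :: 'k pol3 \<Rightarrow> 'k pol3"
  have J: "pol_derivation ?J" by (rule pol_derivation_jacobian)
  then show "pol_derivation (\<lambda>h. pconst c * ?J h)"
    by (simp add: pol_derivation_def algebra_simps)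
  have pow: "((\<lambda>h. pconst c * ?J h) ^^ n) h = pconst (c ^ n) * (?J ^^ n) h" for n h
    by (induction n) (simp_all add: der_mult[OF J] der_pconst[OF J] pconst_mult mult.assoc)
  have "locally_nilpotent ?J"
    by (rule Delta_locally_nilpotent[OF form_f_def form_g_def form_r_def refl])
  then show "locally_nilpotent (\<lambda>h. pconst c * ?J h)"
    unfolding locally_nilpotent_def pow by (metis mult_zero_right)
qed

lemma flow_Aut3: "flow c \<in> carrier Aut3"
  unfolding flow_def by (rule exp_derivation_Aut3[OF scaled_Delta])

lemma flow_hom: "pol_algebra_hom (flow c)"
  using flow_Aut3[of c] by (simp add: Aut3_simps)

text \<open>The derivation kills f, g and hence their product, so the series of r stops after its
  linear term.\<close>

lemma flow_fgr:
  fixes c :: "'k::field_char_0"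
  shows "flow c fpol = fpol" "flow c gpol = gpol"
    "flow c rpol = rpol - pconst c * fpol * gpol"
proof -
  let ?D = "\<lambda>h. pconst c * jacobian_derivation fpol gpol h :: 'k pol3"
  have J: "pol_derivation (jacobian_derivation fpol gpol :: 'k pol3 \<Rightarrow> 'k pol3)"
    by (rule pol_derivation_jacobian)
  note v = Delta_values[OF form_f_def form_g_def form_r_def refl]
  have "(?D ^^ 1) fpol = 0" "(?D ^^ 1) gpol = 0" by (simp_all add: v)
  from this[THEN exp_derivation_eq[OF scaled_Delta(1)]]
  show "flow c fpol = fpol" "flow c gpol = gpol"
    by (simp_all add: flow_def exp_term_def)
  have "?D rpol = pconst (- c) * (fpol * gpol)" by (simp add: v pconst_uminus)
  moreover have "?D (pconst (- c) * (fpol * gpol)) = 0"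
    by (simp add: v der_mult[OF J] der_pconst[OF J])
  ultimately have "?D (?D rpol) = 0" by simp
  then have "(?D ^^ 2) rpol = 0" by (simp add: numeral_2_eq_2)
  from exp_derivation_eq[OF scaled_Delta(1) this]
  show "flow c rpol = rpol - pconst c * fpol * gpol"
    by (simp add: flow_def exp_term_def numeral_2_eq_2 v algebra_simps)
qed

lemma gpol_neq_0: "(gpol :: 'k::field_char_0 pol3) \<noteq> 0"
  using pre_state_id by (auto simp: tdeg.pre_state_def tdeg.dg_def)

lemma fpol_neq_0: "(fpol :: 'k::field_char_0 pol3) \<noteq> 0"
  using dg_fpol by (auto simp: tdeg.dg_def)

lemma flow_flow: "flow c \<circ> flow d = flow (c + d)"
  by (rule pol_hom_eqI_fgr)
     (simp_all add: pol_hom_comp flow_hom flow_fgr hom_diff[OF flow_hom] hom_mult[OF flow_hom]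
       hom_pconst[OF flow_hom] fpol_neq_0 gpol_neq_0 pconst_add algebra_simps)

lemma pol_hom_id: "pol_algebra_hom id"
  by (simp add: pol_algebra_hom_def)

lemma flow_0: "flow 0 = id"
  by (rule pol_hom_eqI_fgr)
     (simp_all add: flow_hom flow_fgr fpol_neq_0 gpol_neq_0 pol_hom_id)

text \<open>Weights 3, 2, 1 make f, g, r homogeneous of weights 4, 9, 6; these maps are exactly the
  exceptions in \<open>pre_state_affine_image\<close>.\<close>

definition torus :: "('k::field_char_0 pol3 \<Rightarrow> 'k pol3) \<Rightarrow> bool" where
  "torus \<alpha> \<longleftrightarrow> (\<exists>s. s \<noteq> 0 \<and> \<alpha> (pvar 1) = pconst (s ^ 3) * pvar 1 \<and>
     \<alpha> (pvar 2) = pconst (s\<^sup>2) * pvar 2 \<and> \<alpha> (pvar 3) = pconst s * pvar 3)"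

lemma pconst_diff: "pconst (a - b) = pconst a - pconst b"
  using pconst_add[of a "- b"] by (simp add: pconst_uminus)

lemma pconst_power: "pconst (c ^ n) = pconst c ^ n"
  by (induction n) (simp_all add: pconst_mult)

lemma pconst_eq_0_iff: "pconst c = 0 \<longleftrightarrow> c = 0"
  by (metis lookup_single_eq lookup_zero pconst_0 pconst_def)

lemma flow_torus:
  fixes \<alpha> :: "'k::field_char_0 pol3 \<Rightarrow> 'k pol3"
  assumes "pol_algebra_hom \<alpha>" "torus \<alpha>"
  shows "\<exists>c. \<alpha> \<circ> flow d = flow c \<circ> \<alpha>"
proof -
  obtain s where s: "s \<noteq> 0" "\<alpha> (pvar 1) = pconst (s ^ 3) * pvar 1"
     "\<alpha> (pvar 2) = pconst (s\<^sup>2) * pvar 2" "\<alpha> (pvar 3) = pconst s * pvar 3"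
    using assms(2) unfolding torus_def by blast
  let ?s = "pconst s :: 'k pol3"
  have f: "\<alpha> fpol = pconst (s ^ 4) * fpol"
    unfolding hom_form_f[OF assms(1)] unfolding s pconst_power form_f_def
    by (simp add: eval_nat_numeral algebra_simps)
  have g: "\<alpha> gpol = pconst (s ^ 9) * gpol"
    unfolding hom_form_g[OF assms(1)] unfolding form_g_def
    unfolding fgr_of_hom(1)[OF assms(1)] f unfolding s pconst_power
    by (simp add: eval_nat_numeral algebra_simps)
  have r: "\<alpha> rpol = pconst (s ^ 6) * rpol"
    unfolding hom_form_r[OF assms(1)] unfolding form_r_def
    unfolding fgr_of_hom(1)[OF assms(1)] f unfolding s pconst_power
    by (simp add: eval_nat_numeral algebra_simps)
  \<comment> \<open>The exponent is 4 + 9 - 6, the weight of \<open>fpol * gpol\<close> minus that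
    of \<open>rpol\<close>.\<close>
  have "\<alpha> \<circ> flow d = flow (d * s ^ 7) \<circ> \<alpha>"
  proof (rule pol_hom_eqI_fgr)
    show "pol_algebra_hom (\<alpha> \<circ> flow d)" "pol_algebra_hom (flow (d * s ^ 7) \<circ> \<alpha>)"
      by (intro pol_hom_comp assms flow_hom)+
    have "pconst d * (pconst (s ^ 4) * fpol) * (pconst (s ^ 9) * gpol)
      = pconst (s ^ 6) * (pconst (d * s ^ 7) * fpol * gpol)"
      unfolding pconst_mult pconst_power by (simp add: eval_nat_numeral algebra_simps)
    then show "(\<alpha> \<circ> flow d) rpol = (flow (d * s ^ 7) \<circ> \<alpha>) rpol"
      by (simp add: flow_fgr r f g hom_diff[OF assms(1)] hom_mult[OF assms(1)] hom_pconst[OF assms(1)]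
          hom_mult[OF flow_hom] hom_pconst[OF flow_hom] right_diff_distrib)
  qed (use s(1) in \<open>simp_all add: flow_fgr f g hom_mult[OF flow_hom] hom_pconst[OF flow_hom]
        fpol_neq_0 gpol_neq_0 pconst_eq_0_iff\<close>)
  then show ?thesis by blast
qed

section \<open>Degree changes along flow and affine letters\<close>

abbreviation Pre :: "('k::field_char_0 pol3 \<Rightarrow> 'k pol3) \<Rightarrow> bool" where
  "Pre \<psi> \<equiv> tdeg.pre_state (\<psi> (pvar 1)) (\<psi> (pvar 2)) (\<psi> (pvar 3))"

abbreviation Post :: "('k::field_char_0 pol3 \<Rightarrow> 'k pol3) \<Rightarrow> nat \<Rightarrow> nat \<Rightarrow> bool" where
  "Post \<psi> \<equiv> tdeg.post_state (\<psi> (pvar 1)) (\<psi> (pvar 2)) (\<psi> (pvar 3))"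

text \<open>The flow keeps the images of f and g and subtracts \<open>c\<close> times their product
  from that of r; its degree \<open>F + G\<close> exceeds the old one.\<close>

lemma Post_comp_flow:
  fixes \<psi> :: "'k::field_char_0 pol3 \<Rightarrow> 'k pol3"
  assumes hom: "pol_algebra_hom \<psi>" and pre: "Pre \<psi>" and "c \<noteq> 0"
  shows "\<exists>F G. Post (\<psi> \<circ> flow c) F G"
proof -
  obtain F G where *: "tdeg.dg (\<psi> fpol) F" "tdeg.dg (\<psi> gpol) G" "tdeg (\<psi> rpol) < F + G"
    "1 \<le> F" "1 \<le> G" "F < 2 * G"
    using pre unfolding tdeg.pre_state_def fgr_of_hom[OF hom] by blast
  note hom' = pol_hom_comp[OF hom flow_hom]
  have "tdeg.dg (- (pconst c * (\<psi> fpol * \<psi> gpol)) + \<psi> rpol) (F + G)"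
    using * \<open>c \<noteq> 0\<close>
    by (intro tdeg.dg_add tdeg.dg_uminus tdeg.dg_cmult tdeg.dg_mult)
       (auto simp: tdeg_pconst pconst_eq_0_iff)
  then have "Post (\<psi> \<circ> flow c) F G"
    unfolding tdeg.post_state_def fgr_of_hom[OF hom'] using *
    by (simp add: flow_fgr hom_diff[OF hom] hom_mult[OF hom] hom_pconst[OF hom] mult.assoc)
  then show ?thesis by blast
qed

lemma Pre_comp_affine:
  fixes \<psi> :: "'k::field_char_0 pol3 \<Rightarrow> 'k pol3"
  assumes hom: "pol_algebra_hom \<psi>" and post: "Post \<psi> F G"
    and \<alpha>: "\<alpha> \<in> Aff3" "\<not> torus \<alpha>"
  shows "Pre (\<psi> \<circ> \<alpha>)"
proof -
  obtain A b where A: "invertible A"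
    "\<And>j. \<alpha> (pvar j) = (\<Sum>i\<in>UNIV. pvar i * pconst (A $ i $ j)) + pconst (b $ j)"
    using \<alpha>(1) unfolding Aff3_iff by blast
  let ?a = "\<lambda>i j. pconst (A $ i $ j) :: 'k pol3" and ?b = "\<lambda>j. pconst (b $ j) :: 'k pol3"
  have img: "(\<psi> \<circ> \<alpha>) (pvar j) = ?a 3 j * \<psi> (pvar 3) + ?a 2 j * \<psi> (pvar 2) + ?a 1 j * \<psi> (pvar 1) + ?b j" for j
    by (simp add: A(2) sum_3 hom_add[OF hom] hom_mult[OF hom] hom_pconst[OF hom] algebra_simps)
  interpret affine_image tdeg "\<psi> (pvar 1)" "\<psi> (pvar 2)" "\<psi> (pvar 3)" F G
    "?a 3 1" "?a 2 1" "?a 1 1" "?b 1" "?a 3 2" "?a 2 2" "?a 1 2" "?b 2" "?a 3 3" "?a 2 3" "?a 1 3" "?b 3"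
  proof (unfold_locales, rule post)
    \<comment> \<open>Listing row 3 before row 1 exchanges two rows of \<open>A\<close>, which
      accounts for the sign.\<close>
    have "?a 3 1 * (?a 2 2 * ?a 1 3 - ?a 1 2 * ?a 2 3) - ?a 2 1 * (?a 3 2 * ?a 1 3 - ?a 1 2 * ?a 3 3)
      + ?a 1 1 * (?a 3 2 * ?a 2 3 - ?a 2 2 * ?a 3 3) = pconst (- det A)"
      unfolding det_3 by (simp add: pconst_uminus pconst_add pconst_diff pconst_mult algebra_simps)
    moreover have "det A \<noteq> 0" using A(1) by (simp add: invertible_det_nz)
    ultimately show "?a 3 1 * (?a 2 2 * ?a 1 3 - ?a 1 2 * ?a 2 3)
      - ?a 2 1 * (?a 3 2 * ?a 1 3 - ?a 1 2 * ?a 3 3) + ?a 1 1 * (?a 3 2 * ?a 2 3 - ?a 2 2 * ?a 3 3) \<noteq> 0"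
      by (simp only: pconst_eq_0_iff neg_equal_0_iff_equal not_False_eq_True)
  qed (simp_all add: tdeg.is_const_def tdeg_pconst)
  have "\<not> (?a 3 1 = 0 \<and> ?a 2 1 = 0 \<and> ?a 3 2 = 0 \<and> ?a 1 1 = ?a 3 3 ^ 3 \<and> ?a 2 2 = (?a 3 3)\<^sup>2 \<and>
    ?a 1 2 = 0 \<and> ?a 2 3 = 0 \<and> ?a 1 3 = 0 \<and> ?b 1 = 0 \<and> ?b 2 = 0 \<and> ?b 3 = 0)"
  proof (rule notI, elim conjE)
    assume *: "?a 3 1 = 0" "?a 2 1 = 0" "?a 3 2 = 0" "?a 1 1 = ?a 3 3 ^ 3" "?a 2 2 = (?a 3 3)\<^sup>2"
      "?a 1 2 = 0" "?a 2 3 = 0" "?a 1 3 = 0" "?b 1 = 0" "?b 2 = 0" "?b 3 = 0"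
    have "A $ 3 $ 3 \<noteq> 0" using * det by auto
    moreover have "\<alpha> (pvar 1) = pconst ((A $ 3 $ 3) ^ 3) * pvar 1"
      "\<alpha> (pvar 2) = pconst ((A $ 3 $ 3)\<^sup>2) * pvar 2" "\<alpha> (pvar 3) = pconst (A $ 3 $ 3) * pvar 3"
      unfolding A(2) sum_3 * pconst_power by simp_all
    ultimately show False using \<alpha>(2) unfolding torus_def by blast
  qed
  from pre_state_affine_image[OF this] show ?thesis
    unfolding v1_def v2_def v3_def img .
qed

subsection \<open>Words in the flow and affine automorphisms\<close>

text \<open>The side conditions make degrees alternate: a flow with \<open>c \<noteq> 0\<close>
  leads from \<open>Pre\<close> to \<open>Post\<close>, an affine map outside the torus back to
  \<open>Pre\<close>.\<close>

inductive_set reduced_words :: "('k::field_char_0 pol3 \<Rightarrow> 'k pol3) set" where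
  id: "id \<in> reduced_words"
| step: "p \<in> reduced_words \<Longrightarrow> c \<noteq> 0 \<Longrightarrow> \<alpha> \<in> Aff3 \<Longrightarrow> \<not> torus \<alpha> \<Longrightarrow>
    p \<circ> flow c \<circ> \<alpha> \<in> reduced_words"

lemma reduced_words_Pre: "p \<in> reduced_words \<Longrightarrow> pol_algebra_hom p \<and> Pre p"
proof (induction rule: reduced_words.induct)
  case id
  then show ?case using pre_state_id by (simp add: pol_algebra_hom_def)
next
  case (step p c \<alpha>)
  then obtain F G where post: "Post (p \<circ> flow c) F G" using Post_comp_flow by blast
  have hom: "pol_algebra_hom (p \<circ> flow c)" using step.IH pol_hom_comp flow_hom by blast
  show ?case
    using Pre_comp_affine[OF hom post step.hyps(3,4)] pol_hom_comp[OF hom Aff3_hom[OF step.hyps(3)]]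
    by blast
qed

text \<open>The last flow may be trivial, so that the affine maps belong to the set and it is closed
  under composing generators on the right.\<close>

definition words :: "('k::field_char_0 pol3 \<Rightarrow> 'k pol3) set" where
  "words = {\<alpha> \<circ> p \<circ> flow c \<circ> \<beta> | \<alpha> p c \<beta>. \<alpha> \<in> Aff3 \<and> p \<in> reduced_words \<and> \<beta> \<in> Aff3}"

lemma wordsI: "\<alpha> \<in> Aff3 \<Longrightarrow> p \<in> reduced_words \<Longrightarrow> \<beta> \<in> Aff3 \<Longrightarrow> w = \<alpha> \<circ> p \<circ> flow c \<circ> \<beta> \<Longrightarrow> w \<in> words"
  unfolding words_def by blast

lemma words_comp_Aff3:
  assumes "w \<in> words" "\<gamma> \<in> Aff3"
  shows "w \<circ> \<gamma> \<in> words"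
proof -
  obtain \<alpha> p c \<beta> where "w = \<alpha> \<circ> p \<circ> flow c \<circ> \<beta>" "\<alpha> \<in> Aff3" "p \<in> reduced_words" "\<beta> \<in> Aff3"
    using assms(1) unfolding words_def by blast
  then show ?thesis
    using assms(2) by (intro wordsI[of \<alpha> p "\<beta> \<circ> \<gamma>" _ c] Aff3_comp) (simp_all add: comp_assoc)
qed

lemma words_comp_flow_torus:
  assumes "\<alpha> \<in> Aff3" "p \<in> reduced_words" "\<beta> \<in> Aff3" "torus \<beta>"
  shows "\<alpha> \<circ> p \<circ> flow c \<circ> \<beta> \<circ> flow d \<in> words"
proof -
  obtain e where "\<beta> \<circ> flow d = flow e \<circ> \<beta>" using flow_torus Aff3_hom assms by blast
  then have "\<alpha> \<circ> p \<circ> flow c \<circ> \<beta> \<circ> flow d = \<alpha> \<circ> p \<circ> (flow c \<circ> flow e) \<circ> \<beta>"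
    by (simp add: comp_assoc)
  then show ?thesis unfolding flow_flow by (rule wordsI[OF assms(1-3)])
qed

lemma words_comp_flow_not_torus:
  assumes "\<alpha> \<in> Aff3" "p \<in> reduced_words" "\<beta> \<in> Aff3" "\<not> torus \<beta>" "c \<noteq> 0"
  shows "\<alpha> \<circ> p \<circ> flow c \<circ> \<beta> \<circ> flow d \<in> words"
  by (rule wordsI[OF assms(1) reduced_words.step[OF assms(2,5,3,4)] Aff3_id, of _ d])
     (simp add: comp_assoc)

text \<open>If \<open>\<beta>\<close> is in the torus, the new flow passes through it and merges
  with \<open>flow c\<close>; otherwise, for \<open>c \<noteq> 0\<close>,
  \<open>flow c \<circ> \<beta>\<close> extends the reduced word.\<close>

lemma words_comp_flow: assumes "w \<in> words" shows "w \<circ> flow d \<in> words"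
proof -
  obtain \<alpha> p c \<beta> where w: "w = \<alpha> \<circ> p \<circ> flow c \<circ> \<beta>"
    and *: "\<alpha> \<in> Aff3" "p \<in> reduced_words" "\<beta> \<in> Aff3"
    using assms unfolding words_def by blast
  show ?thesis
  proof (cases "torus \<beta> \<or> c \<noteq> 0")
    case True
    then show ?thesis unfolding w using words_comp_flow_torus words_comp_flow_not_torus * by blast
  next
    case False
    then have w': "w = \<alpha> \<circ> p \<circ> \<beta>" unfolding w by (simp add: flow_0)
    from *(2) show ?thesis
    proof (cases rule: reduced_words.cases)
      case id
      then show ?thesis
        unfolding w' by (intro wordsI[OF Aff3_comp[OF *(1,3)] reduced_words.id Aff3_id]) simp
    next
      \<comment> \<open>With \<open>c = 0\<close> the last affine letter \<open>\<gamma>\<close>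
        meets \<open>\<beta>\<close>, and their product may lie in the torus although neither
        does.\<close>
      case (step q e \<gamma>)
      have "w \<circ> flow d = \<alpha> \<circ> q \<circ> flow e \<circ> (\<gamma> \<circ> \<beta>) \<circ> flow d"
        unfolding w' step by (simp add: comp_assoc)
      moreover have "\<dots> \<in> words"
      proof (cases "torus (\<gamma> \<circ> \<beta>)")
        case True
        then show ?thesis by (rule words_comp_flow_torus[OF *(1) step(2) Aff3_comp[OF step(4) *(3)]])
      next
        case False
        then show ?thesis
          using step(3) by (rule words_comp_flow_not_torus[OF *(1) step(2) Aff3_comp[OF step(4) *(3)]])
      qed
      ultimately show ?thesis by (simp only:)
    qed
  qed
qed

lemma id_words: "id \<in> words"
  by (rule wordsI[OF Aff3_id reduced_words.id Aff3_id, of _ 0]) (simp add: flow_0)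

lemma generate_subset_words: "generate Aut3 (insert (flow 1) Aff3) \<subseteq> words"
proof
  fix h assume "h \<in> generate Aut3 (insert (flow 1) Aff3)"
  \<comment> \<open>Quantifying over all prefixes \<open>w\<close> lets the claim pass through
    products; the prefix \<open>id\<close> gives the result.\<close>
  then have "\<forall>w\<in>words. w \<circ> h \<in> words"
  proof (induction rule: generate.induct)
    case one
    then show ?case by (simp add: Aut3_simps)
  next
    case (incl h)
    then show ?case using words_comp_Aff3 words_comp_flow by blast
  next
    case (inv h)
    show ?case
    proof (cases "h \<in> Aff3")
      case True
      then obtain k where k: "k \<in> Aff3" "k \<circ> h = id" using Aff3_inv by blast
      then have "inv\<^bsub>Aut3\<^esub> h = k" using Aut3_inv True Aff3_carrier by blast
      then show ?thesis using k words_comp_Aff3 by metis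
    next
      case False
      then have "inv\<^bsub>Aut3\<^esub> h = flow (- 1)"
        using inv Aut3_inv[OF flow_Aut3[of 1] _ flow_Aut3[of "- 1"]] by (simp add: flow_flow flow_0)
      then show ?thesis using words_comp_flow by metis
    qed
  next
    case (eng h1 h2)
    then show ?case unfolding Aut3_simps o_assoc by blast
  qed
  then show "h \<in> words" using id_words by fastforce
qed

text \<open>The degree of the third image is \<open>4 * F + 3 * G\<close>, which is least at
  \<open>F = G = 1\<close>.\<close>

lemma word_degree:
  assumes "p \<in> reduced_words" "c \<noteq> 0"
  shows "7 \<le> tdeg ((p \<circ> flow c) (pvar 3))"
proof -
  from reduced_words_Pre[OF assms(1)] obtain F G where post: "Post (p \<circ> flow c) F G"
    using Post_comp_flow assms(2) by blast
  then have "1 \<le> F" "1 \<le> G" by (auto simp: tdeg.post_state_def)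
  then show ?thesis using tdeg.post_state_degrees(3)[OF post] by (simp add: tdeg.dg_def)
qed

text \<open>The outer affine factors are cancelled. If the last flow is trivial, the last letter of
  \<open>p\<close> takes its role, and only an empty \<open>p\<close> leaves an affine map.\<close>

lemma words_cases:
  assumes "w \<in> words"
  obtains (affine) "w \<in> Aff3" | (conj) \<alpha> \<beta> where "\<alpha> \<in> Aff3" "\<beta> \<in> Aff3" "7 \<le> tdeg ((\<alpha> \<circ> w \<circ> \<beta>) (pvar 3))"
proof -
  have *: thesis if w: "w = \<alpha> \<circ> p \<circ> flow c \<circ> \<beta>" and "\<alpha> \<in> Aff3" "p \<in> reduced_words" "\<beta> \<in> Aff3" "c \<noteq> 0"
    for \<alpha> p c \<beta>
  proof -
    obtain \<alpha>' \<beta>' where inv: "\<alpha>' \<in> Aff3" "\<beta>' \<in> Aff3" "\<alpha>' \<circ> \<alpha> = id" "\<beta> \<circ> \<beta>' = id"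
      using Aff3_inv[OF \<open>\<alpha> \<in> Aff3\<close>] Aff3_inv[OF \<open>\<beta> \<in> Aff3\<close>] by blast
    have "\<alpha>' \<circ> w \<circ> \<beta>' = (\<alpha>' \<circ> \<alpha>) \<circ> (p \<circ> flow c) \<circ> (\<beta> \<circ> \<beta>')"
      unfolding w by (simp add: comp_assoc)
    then have "\<alpha>' \<circ> w \<circ> \<beta>' = p \<circ> flow c" using inv by simp
    with word_degree[OF \<open>p \<in> reduced_words\<close> \<open>c \<noteq> 0\<close>]
    have "7 \<le> tdeg ((\<alpha>' \<circ> w \<circ> \<beta>') (pvar 3))" by (simp only:)
    then show thesis by (rule conj[OF inv(1,2)])
  qed
  obtain \<alpha> p c \<beta> where w: "w = \<alpha> \<circ> p \<circ> flow c \<circ> \<beta>"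
    and p: "\<alpha> \<in> Aff3" "p \<in> reduced_words" "\<beta> \<in> Aff3"
    using assms unfolding words_def by blast
  show thesis
  proof (cases "c = 0")
    case False
    then show thesis using * w p by blast
  next
    case True
    then have w': "w = \<alpha> \<circ> p \<circ> \<beta>" unfolding w by (simp add: flow_0)
    from p(2) show thesis
    proof (cases rule: reduced_words.cases)
      case id
      then have "w = \<alpha> \<circ> \<beta>" unfolding w' by simp
      then show ?thesis using affine Aff3_comp p by blast
    next
      case (step q e \<gamma>)
      have "w = \<alpha> \<circ> q \<circ> flow e \<circ> (\<gamma> \<circ> \<beta>)" unfolding w' step by (simp add: comp_assoc)
      then show ?thesis using * step p Aff3_comp by blast
    qed
  qed
qed

section \<open>A quadratic tame automorphism outside the generated group\<close>

lemma tdeg_hom_affine_le: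
  fixes \<psi> \<alpha> :: "'k::field_char_0 pol3 \<Rightarrow> 'k pol3"
  assumes "pol_algebra_hom \<psi>" "\<And>i. tdeg (\<psi> (pvar i)) \<le> n" "\<alpha> \<in> Aff3"
  shows "tdeg ((\<psi> \<circ> \<alpha>) (pvar j)) \<le> n"
proof -
  obtain A b where "\<alpha> (pvar j) = (\<Sum>i\<in>UNIV. pvar i * pconst (A $ i $ j)) + pconst (b $ j)"
    using assms(3) unfolding Aff3_iff by blast
  then have "(\<psi> \<circ> \<alpha>) (pvar j) = pconst (A $ 1 $ j) * \<psi> (pvar 1) + pconst (A $ 2 $ j) * \<psi> (pvar 2)
     + pconst (A $ 3 $ j) * \<psi> (pvar 3) + pconst (b $ j)"
    by (simp add: sum_3 hom_add[OF assms(1)] hom_mult[OF assms(1)] hom_pconst[OF assms(1)] mult.commute)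
  then show ?thesis
    by (simp only:, intro tdeg.d_add_le tdeg.d_cmult_le) (simp_all add: tdeg_pconst assms(2))
qed

lemma tdeg_affine_le:
  fixes \<alpha> :: "'k::field_char_0 pol3 \<Rightarrow> 'k pol3"
  assumes "\<alpha> \<in> Aff3" shows "tdeg (\<alpha> (pvar j)) \<le> 1"
  using tdeg_hom_affine_le[of id 1 \<alpha> j] assms by (simp add: tdeg_pvar pol_hom_id)

text \<open>Obtained as the exponential of \<open>(pvar 1)\<^sup>2 * pdiff 3 h\<close>, so that
  bijectivity comes from \<open>exp_derivation_Aut3\<close>.\<close>

lemma elementary_quadratic:
  obtains \<tau> :: "'k::field_char_0 pol3 \<Rightarrow> 'k pol3"
  where "\<tau> \<in> BA3" "\<tau> (pvar 1) = pvar 1" "\<tau> (pvar 2) = pvar 2" "\<tau> (pvar 3) = pvar 3 + (pvar 1)\<^sup>2"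
proof -
  define D :: "'k pol3 \<Rightarrow> 'k pol3" where "D h = (pvar 1)\<^sup>2 * pdiff 3 h" for h
  have der: "pol_derivation D"
    by (simp add: D_def[abs_def] pol_derivation_def pdiff_add pdiff_mult algebra_simps)
  have D: "(D ^^ 1) (pvar 1) = 0" "(D ^^ 1) (pvar 2) = 0" "(D ^^ 2) (pvar 3) = 0"
    by (simp_all add: D_def pdiff_simps power2_eq_square numeral_2_eq_2)
  have nil: "locally_nilpotent D"
  proof (rule locally_nilpotent_if_on_pvars[OF der])
    fix i :: 3
    consider "i = 1" | "i = 2" | "i = 3" using exhaust_3[of i] by blast
    then show "\<exists>l. (D ^^ l) (pvar i) = 0" using D by cases blast+
  qed
  note val = D[THEN exp_derivation_eq[OF der]]
  have vals: "exp_derivation D (pvar 1) = pvar 1" "exp_derivation D (pvar 2) = pvar 2"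
    "exp_derivation D (pvar 3) = pvar 3 + (pvar 1)\<^sup>2"
    unfolding val by (simp_all add: exp_term_def numeral_2_eq_2 D_def pdiff_simps)
  have "(pvar 1)\<^sup>2 \<in> (pols_in {1, 2} :: 'k pol3 set)"
    by (auto simp: pols_in_def pvar_def power2_eq_square mult_single simp flip: single_add split: if_splits)
  moreover have "(0 :: 'k pol3) \<in> pols_in V" for V by (simp add: pols_in_def)
  ultimately have "exp_derivation D \<in> BA3"
    unfolding BA3_def using exp_derivation_Aut3[OF der nil]
    by (intro CollectI conjI exI[of _ 1] exI[of _ 0] exI[of _ "(pvar 1)\<^sup>2"]) (simp_all add: vals)
  then show thesis using that vals by blast
qed

theorem theorem2p1:
  fixes f g :: "'k::field_char_0 pol3"
    and \<Delta> \<phi> :: "'k pol3 \<Rightarrow> 'k pol3"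
  assumes "f = pvar 1 * pvar 3 - (pvar 2)\<^sup>2"
    and "g = pvar 3 * f\<^sup>2 + 2 * pvar 1 * pvar 2 * f + (pvar 1) ^ 3"
    and "\<Delta> = jacobian_derivation f g"
    and "\<phi> = exp_derivation \<Delta>"
  shows "\<not> co_tame \<phi>"
proof
  assume "co_tame \<phi>"
  have f: "f = fpol" using assms(1) by (simp add: form_f_def)
  have g: "g = gpol" using assms(2) unfolding f by (simp add: form_g_def)
  have "\<phi> = flow 1" by (simp add: assms(3,4) f g flow_def)
  obtain \<tau> :: "'k pol3 \<Rightarrow> 'k pol3" where \<tau>: "\<tau> \<in> BA3" "\<tau> (pvar 1) = pvar 1"
    "\<tau> (pvar 2) = pvar 2" "\<tau> (pvar 3) = pvar 3 + (pvar 1)\<^sup>2"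
    by (rule elementary_quadratic)
  have hom: "pol_algebra_hom \<tau>" using \<tau>(1) by (simp add: BA3_def Aut3_simps)
  have "\<tau> \<in> TA3" unfolding TA3_def using \<tau>(1) by (intro generate.incl) simp
  then have "\<tau> \<in> words"
    using \<open>co_tame \<phi>\<close> generate_subset_words unfolding co_tame_def \<open>\<phi> = flow 1\<close> by blast
  then show False
  proof (cases rule: words_cases)
    case affine
    have "tdeg.dg ((pvar 1)\<^sup>2 + pvar 3 :: 'k pol3) (2 * 1)"
      by (intro tdeg.dg_add tdeg.dg_power) (simp_all add: tdeg.dg_def tdeg_pvar pvar_neq_0)
    then have "tdeg (\<tau> (pvar 3)) = 2" by (simp add: \<tau> tdeg.dg_def add.commute)
    then show False using tdeg_affine_le[OF affine, of 3] by simp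
  next
    case (conj \<alpha> \<beta>)
    note hom\<alpha> = Aff3_hom[OF conj(1)]
    note le = tdeg_affine_le[OF conj(1)]
    \<comment> \<open>Affine factors on both sides of \<open>\<tau>\<close> keep the degree at most
      2, against the required 7.\<close>
    have "tdeg ((\<alpha> \<circ> \<tau>) (pvar i)) \<le> 2" for i
    proof -
      have "tdeg (\<alpha> (pvar 3) + \<alpha> (pvar 1) ^ 2) \<le> 2"
        using le[of 3] le[of 1] tdeg.d_power_le[of "\<alpha> (pvar 1)" 2] by (intro tdeg.d_add_le) simp_all
      then show ?thesis
        using exhaust_3[of i] le[of 1] le[of 2] \<tau>
        by (auto simp: hom_add[OF hom\<alpha>] hom_power[OF hom\<alpha>])
    qed
    from tdeg_hom_affine_le[OF pol_hom_comp[OF hom\<alpha> hom] this conj(2), of 3] conj(3)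
    show False by simp
  qed
qed

end
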